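(* Let $H:\mathbb{R}^d\times\mathscr{P}_2(\mathbb{R}^d)\times\mathbb{R}^d\to\mathbb{R}$, $(x,\mu,p)\mapsto H(x,\mu,p)$, be fully $C^2$ and suppose that there is $c_0>0$ with $\partial_{pp}H(x,\mu,p)\ge c_0^{-1}I$ for all $(x,\mu,p)\in\mathbb{R}^d\times\mathscr{P}_2(\mathbb{R}^d)\times\mathbb{R}^d$. Suppose that the quantities $\underline{\kappa}(\partial_{xp}H)$, $|\partial_{pp}H|$, $|\partial_{xx}H|$, $|\partial_{p\mu}H|$ and $|\partial_{x\mu}H|$ (defined in the context) are finite. Define $$L^H_{our}:=|\partial_{x\mu}H|+\tfrac14 c_0|\partial_{p\mu}H|^2+|\partial_{xx}H|,$$ and suppose that $$\underline{\kappa}(\partial_{xp}H)\ \ge\ \tfrac12|\partial_{p\mu}H|+\sqrt{|\partial_{pp}H|\,L^H_{our}}.$$ Then the function $H_\alpha(x,\mu,p):=H(x,\mu,p-\alpha x)$ is displacement monotone for every $\alpha\in[\alpha^H_-,\alpha^H_+]$, where $$\alpha^H_\pm:=\frac{\underline{\kappa}(\partial_{xp}H)-\frac12|\partial_{p\mu}H|\pm\sqrt{\left(\underline{\kappa}(\partial_{xp}H)-\frac12|\partial_{p\mu}H|\right)^2-|\partial_{pp}H|\,L^H_{our}}}{|\partial_{pp}H|}.$$ In particular, $H_\alpha$ is displacement monotone for $\alpha:=\dfrac{\underline{\kappa}(\partial_{xp}H)-\frac12|\partial_{p\mu}H|}{|\partial_{pp}H|}$.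
   Context: $\mathscr{P}_2(\mathbb{R}^d)$ is the set of Borel probability measures on $\mathbb{R}^d$ with finite second moment, with the 2-Wasserstein metric $W_2$; $\Pi(\mu,\nu)$ is the set of couplings of $\mu$ and $\nu$. Derivatives in the measure: for $U:\mathscr{P}_2(\mathbb{R}^d)\to\mathbb{R}$, $\partial_\mu U(\mu,\tilde x)\in\mathbb{R}^d$ denotes the Wasserstein gradient (Lions derivative), i.e. the lift $\xi\mapsto U(\mathrm{Law}(\xi))$ on $L^2(\Omega;\mathbb{R}^d)$ is Fréchet differentiable with gradient $\partial_\mu U(\mathrm{Law}(\xi),\xi)$. For $H(x,\mu,p)$, $\partial_{x\mu}H(x,\mu,\tilde x,p)$ and $\partial_{p\mu}H(x,\mu,\tilde x,p)$ are the $d\times d$ matrices of mixed derivatives (row index $x$, respectively $p$; column index the component of $\partial_\mu$), and $\tilde x$ is the extra variable of the Wasserstein gradient. A function is fully $C^k$ if all its derivatives up to order $k$ in the Euclidean variables, in the measure and in the extra variables exist and have jointly continuous versions. Notation: $\mathrm{Re}(A):=(A+A^\top)/2$ for $A\in\mathbb{R}^{d\times d}$, $\lambda_{\min}$ is the smallest eigenvalue of a symmetric matrix, and $$\underline{\kappa}(\partial_{xp}H):=\inf_{(x,\mu,p)}\lambda_{\min}\big(\mathrm{Re}\,\partial_{xp}H(x,\mu,p)\big).$$ $|\partial_{pp}H|$, $|\partial_{xx}H|$ denote the suprema over $(x,\mu,p)\in\mathbb{R}^d\times\mathscr{P}_2(\mathbb{R}^d)\times\mathbb{R}^d$ of the matrix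 $2$-norms of $\partial_{pp}H(x,\mu,p)$, $\partial_{xx}H(x,\mu,p)$; $|\partial_{x\mu}H|$, $|\partial_{p\mu}H|$ denote the suprema over $(x,\mu,p,\tilde x)$ of the matrix $2$-norms of $\partial_{x\mu}H$, $\partial_{p\mu}H$. Displacement monotonicity of a Hamiltonian: a function $K:\mathbb{R}^d\times\mathscr{P}_2(\mathbb{R}^d)\times\mathbb{R}^d\to\mathbb{R}$ with $K(\cdot,\mu,\cdot)\in C^1(\mathbb{R}^d\times\mathbb{R}^d)$ for all $\mu$ is displacement monotone if $$-\int_{\mathbb{R}^d\times\mathbb{R}^d}[\partial_xK(x,\mu,p^1(x))-\partial_xK(y,\nu,p^2(y))]\cdot(x-y)\,d\gamma(x,y)+\int_{\mathbb{R}^d\times\mathbb{R}^d}[\partial_pK(x,\mu,p^1(x))-\partial_pK(y,\nu,p^2(y))]\cdot(p^1(x)-p^2(y))\,d\gamma(x,y)\ge0$$ for all $\mu,\nu\in\mathscr{P}_2(\mathbb{R}^d)$, all $\gamma\in\Pi(\mu,\nu)$ and all $p^1,p^2\in C_b(\mathbb{R}^d;\mathbb{R}^d)$ (for which the integrals are well defined). *)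

theory Defs
  imports "HOL-Probability.Probability"
begin

section \<open>The Wasserstein space\<close>

definition P2 :: "'a::euclidean_space measure set" where
  "P2 = {\<mu>. prob_space \<mu> \<and> sets \<mu> = sets borel \<and> integrable \<mu> (\<lambda>x. (norm x)\<^sup>2)}"

definition couplings :: "'a::euclidean_space measure \<Rightarrow> 'a measure \<Rightarrow> ('a \<times> 'a) measure set" where
  "couplings \<mu> \<nu> = {\<gamma>. prob_space \<gamma> \<and> sets \<gamma> = sets borel \<and>
     distr \<gamma> borel fst = \<mu> \<and> distr \<gamma> borel snd = \<nu>}"

definition W2 :: "'a::euclidean_space measure \<Rightarrow> 'a measure \<Rightarrow> real" where
  "W2 \<mu> \<nu> = sqrt (INF \<gamma>\<in>couplings \<mu> \<nu>. \<integral>z. (norm (fst z - snd z))\<^sup>2 \<partial>\<gamma>)"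

text \<open>Functions on \<open>P2\<close> are total functions on measures whose values outside \<open>P2\<close> are never
  used.  A family \<open>f e \<mu>\<close> has all its Euclidean variables collected in the single variable \<open>e\<close>;
  joint continuity is that of the metric space \<open>E \<times> (P2, W2)\<close>.\<close>

definition jointly_continuous ::
  "('e::metric_space \<Rightarrow> 'a::euclidean_space measure \<Rightarrow> 'b::metric_space) \<Rightarrow> bool" where
  "jointly_continuous f \<longleftrightarrow>
     (\<forall>e. \<forall>\<mu>\<in>P2. \<forall>\<epsilon>>0. \<exists>\<delta>>0. \<forall>e'. \<forall>\<nu>\<in>P2.
        dist e' e < \<delta> \<and> W2 \<nu> \<mu> < \<delta> \<longrightarrow> dist (f e' \<nu>) (f e \<mu>) < \<epsilon>)"


section \<open>The Wasserstein gradient\<close>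

text \<open>The lift lives on the atomless standard probability space given by Lebesgue measure on the
  unit interval.  \<open>L2\<close> consists of functions rather than of classes modulo null sets; laws,
  norms and integrals do not see the difference.\<close>

definition Omega :: "real measure" where
  "Omega = restrict_space lborel {0<..<1}"

definition L2 :: "(real \<Rightarrow> 'a::euclidean_space) set" where
  "L2 = {\<xi>. \<xi> \<in> borel_measurable Omega \<and> integrable Omega (\<lambda>\<omega>. (norm (\<xi> \<omega>))\<^sup>2)}"

definition L2norm :: "(real \<Rightarrow> 'a::euclidean_space) \<Rightarrow> real" where
  "L2norm \<xi> = sqrt (\<integral>\<omega>. (norm (\<xi> \<omega>))\<^sup>2 \<partial>Omega)"

definition Law :: "(real \<Rightarrow> 'a::euclidean_space) \<Rightarrow> 'a measure" where
  "Law \<xi> = distr Omega borel \<xi>"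

definition is_wasserstein_gradient ::
  "('a::euclidean_space measure \<Rightarrow> real) \<Rightarrow> ('a measure \<Rightarrow> 'a \<Rightarrow> 'a) \<Rightarrow> bool" where
  "is_wasserstein_gradient U D \<longleftrightarrow>
     (\<forall>\<xi>\<in>L2. (\<lambda>\<omega>. D (Law \<xi>) (\<xi> \<omega>)) \<in> L2 \<and>
        (\<forall>\<epsilon>>0. \<exists>\<delta>>0. \<forall>\<eta>\<in>L2. L2norm \<eta> < \<delta> \<longrightarrow>
           \<bar>U (Law (\<lambda>\<omega>. \<xi> \<omega> + \<eta> \<omega>)) - U (Law \<xi>) - (\<integral>\<omega>. D (Law \<xi>) (\<xi> \<omega>) \<bullet> \<eta> \<omega> \<partial>Omega)\<bar>
             \<le> \<epsilon> * L2norm \<eta>))"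

text \<open>Jointly continuous versions of the Wasserstein gradient of a family \<open>G e \<mu>\<close>; the extra
  variable is appended to the Euclidean variables.\<close>

definition is_cont_measure_deriv ::
  "('e::metric_space \<Rightarrow> 'a::euclidean_space measure \<Rightarrow> real) \<Rightarrow> ('e \<times> 'a \<Rightarrow> 'a measure \<Rightarrow> 'a) \<Rightarrow> bool"
  where
  "is_cont_measure_deriv G D \<longleftrightarrow>
     jointly_continuous D \<and> (\<forall>e. is_wasserstein_gradient (G e) (\<lambda>\<mu> x'. D (e, x') \<mu>))"

text \<open>For fixed \<open>\<mu>\<close> the gradient is only determined \<open>\<mu>\<close>-almost everywhere, but its jointly
  continuous version is unique for \<open>\<mu> \<in> P2\<close>, because measures of full support are dense in
  \<open>P2\<close>.  The choice below is therefore arbitrary only outside \<open>P2\<close>.\<close>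

definition Dmu ::
  "('e::metric_space \<Rightarrow> 'a::euclidean_space measure \<Rightarrow> real) \<Rightarrow> 'e \<times> 'a \<Rightarrow> 'a measure \<Rightarrow> 'a" where
  "Dmu G = (SOME D. is_cont_measure_deriv G D)"


section \<open>Full regularity\<close>

definition grad :: "('e::euclidean_space \<Rightarrow> real) \<Rightarrow> 'e \<Rightarrow> 'e" where
  "grad f x = (THE D. GDERIV f x :> D)"

definition C1 :: "('e::euclidean_space \<Rightarrow> real) \<Rightarrow> bool" where
  "C1 f \<longleftrightarrow> (\<forall>x. f differentiable at x) \<and> continuous_on UNIV (grad f)"

definition fully_C1 ::
  "('e::euclidean_space \<Rightarrow> 'a::euclidean_space measure \<Rightarrow> real) \<Rightarrow> bool" where
  "fully_C1 G \<longleftrightarrow>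
     jointly_continuous G \<and>
     (\<forall>\<mu>\<in>P2. \<forall>e. (\<lambda>e'. G e' \<mu>) differentiable at e) \<and>
     jointly_continuous (\<lambda>e \<mu>. grad (\<lambda>e'. G e' \<mu>) e) \<and>
     (\<exists>D. is_cont_measure_deriv G D)"

text \<open>Second order: every component of every first-order derivative is fully \<open>C1\<close>, the extra
  variable of the measure derivative counting as one more Euclidean variable.  In particular both
  orders of the mixed derivatives, the second measure derivative and the derivative in the extra
  variable are covered.\<close>

definition fully_C2 ::
  "('e::euclidean_space \<Rightarrow> 'a::euclidean_space measure \<Rightarrow> real) \<Rightarrow> bool" where
  "fully_C2 G \<longleftrightarrow>
     fully_C1 G \<and>
     (\<forall>b\<in>Basis. fully_C1 (\<lambda>e \<mu>. grad (\<lambda>e'. G e' \<mu>) e \<bullet> b)) \<and>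
     (\<forall>b\<in>Basis. fully_C1 (\<lambda>e \<mu>. Dmu G e \<mu> \<bullet> b))"


section \<open>Derivatives of a Hamiltonian\<close>

type_synonym 'n hamiltonian = "real^'n \<Rightarrow> (real^'n) measure \<Rightarrow> real^'n \<Rightarrow> real"

definition Dx :: "'n::finite hamiltonian \<Rightarrow> real^'n \<Rightarrow> (real^'n) measure \<Rightarrow> real^'n \<Rightarrow> real^'n" where
  "Dx H x \<mu> p = grad (\<lambda>x'. H x' \<mu> p) x"

definition Dp :: "'n::finite hamiltonian \<Rightarrow> real^'n \<Rightarrow> (real^'n) measure \<Rightarrow> real^'n \<Rightarrow> real^'n" where
  "Dp H x \<mu> p = grad (\<lambda>p'. H x \<mu> p') p"

definition Dxx :: "'n::finite hamiltonian \<Rightarrow> real^'n \<Rightarrow> (real^'n) measure \<Rightarrow> real^'n \<Rightarrow> real^'n^'n" where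
  "Dxx H x \<mu> p = jacobian (\<lambda>x'. Dx H x' \<mu> p) (at x)"

definition Dxp :: "'n::finite hamiltonian \<Rightarrow> real^'n \<Rightarrow> (real^'n) measure \<Rightarrow> real^'n \<Rightarrow> real^'n^'n" where
  "Dxp H x \<mu> p = jacobian (\<lambda>p'. Dx H x \<mu> p') (at p)"

definition Dpp :: "'n::finite hamiltonian \<Rightarrow> real^'n \<Rightarrow> (real^'n) measure \<Rightarrow> real^'n \<Rightarrow> real^'n^'n" where
  "Dpp H x \<mu> p = jacobian (\<lambda>p'. Dp H x \<mu> p') (at p)"

text \<open>Row \<open>i\<close> of \<open>Dxmu\<close> (\<open>Dpmu\<close>) is the Wasserstein gradient of the \<open>i\<close>-th component of \<open>Dx H\<close>
  (\<open>Dp H\<close>); the third argument is the extra variable.\<close>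

definition Dxmu ::
  "'n::finite hamiltonian \<Rightarrow> real^'n \<Rightarrow> (real^'n) measure \<Rightarrow> real^'n \<Rightarrow> real^'n \<Rightarrow> real^'n^'n" where
  "Dxmu H x \<mu> x' p = (\<chi> i. Dmu (\<lambda>(y, q) \<nu>. Dx H y \<nu> q $ i) ((x, p), x') \<mu>)"

definition Dpmu ::
  "'n::finite hamiltonian \<Rightarrow> real^'n \<Rightarrow> (real^'n) measure \<Rightarrow> real^'n \<Rightarrow> real^'n \<Rightarrow> real^'n^'n" where
  "Dpmu H x \<mu> x' p = (\<chi> i. Dmu (\<lambda>(y, q) \<nu>. Dp H y \<nu> q $ i) ((x, p), x') \<mu>)"


section \<open>Matrix quantities\<close>

definition Re_mat :: "real^'n^'n \<Rightarrow> real^'n^'n" where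
  "Re_mat A = (1/2) *\<^sub>R (A + transpose A)"

definition lambda_min :: "real^'n^'n \<Rightarrow> real" where
  "lambda_min A = (LEAST l. \<exists>v. v \<noteq> 0 \<and> A *v v = l *\<^sub>R v)"

definition norm_2 :: "real^'n^'n \<Rightarrow> real" where
  "norm_2 A = onorm ((*v) A)"

definition mat_ge :: "real^'n^'n \<Rightarrow> real^'n^'n \<Rightarrow> bool" where
  "mat_ge A B \<longleftrightarrow> (\<forall>v. 0 \<le> v \<bullet> ((A - B) *v v))"

text \<open>The sets of values over which the suprema and infima are taken.  \<open>Sup\<close> and \<open>Inf\<close> on the reals are
  meaningful only together with the corresponding boundedness (i.e. finiteness) of these sets.\<close>

definition values3 ::
  "(real^'n^'n \<Rightarrow> real) \<Rightarrow> (real^'n \<Rightarrow> (real^'n) measure \<Rightarrow> real^'n \<Rightarrow> real^'n^'n) \<Rightarrow> real set" where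
  "values3 \<phi> F = {\<phi> (F x \<mu> p) |x \<mu> p. \<mu> \<in> P2}"

definition values4 ::
  "(real^'n^'n \<Rightarrow> real) \<Rightarrow> (real^'n \<Rightarrow> (real^'n) measure \<Rightarrow> real^'n \<Rightarrow> real^'n \<Rightarrow> real^'n^'n) \<Rightarrow> real set"
  where
  "values4 \<phi> F = {\<phi> (F x \<mu> x' p) |x \<mu> x' p. \<mu> \<in> P2}"

definition kappa_low :: "(real^'n \<Rightarrow> (real^'n) measure \<Rightarrow> real^'n \<Rightarrow> real^'n^'n) \<Rightarrow> real" where
  "kappa_low F = Inf (values3 (\<lambda>A. lambda_min (Re_mat A)) F)"

definition sup3 :: "(real^'n \<Rightarrow> (real^'n) measure \<Rightarrow> real^'n \<Rightarrow> real^'n^'n) \<Rightarrow> real" where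
  "sup3 F = Sup (values3 norm_2 F)"

definition sup4 :: "(real^'n \<Rightarrow> (real^'n) measure \<Rightarrow> real^'n \<Rightarrow> real^'n \<Rightarrow> real^'n^'n) \<Rightarrow> real" where
  "sup4 F = Sup (values4 norm_2 F)"

definition L_our :: "real \<Rightarrow> 'n::finite hamiltonian \<Rightarrow> real" where
  "L_our c0 H = sup4 (Dxmu H) + 1/4 * c0 * (sup4 (Dpmu H))\<^sup>2 + sup3 (Dxx H)"

definition alpha_minus :: "real \<Rightarrow> 'n::finite hamiltonian \<Rightarrow> real" where
  "alpha_minus c0 H =
     (kappa_low (Dxp H) - 1/2 * sup4 (Dpmu H)
       - sqrt ((kappa_low (Dxp H) - 1/2 * sup4 (Dpmu H))\<^sup>2 - sup3 (Dpp H) * L_our c0 H))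
     / sup3 (Dpp H)"

definition alpha_plus :: "real \<Rightarrow> 'n::finite hamiltonian \<Rightarrow> real" where
  "alpha_plus c0 H =
     (kappa_low (Dxp H) - 1/2 * sup4 (Dpmu H)
       + sqrt ((kappa_low (Dxp H) - 1/2 * sup4 (Dpmu H))\<^sup>2 - sup3 (Dpp H) * L_our c0 H))
     / sup3 (Dpp H)"


section \<open>Displacement monotonicity\<close>

text \<open>The inequality is required whenever both integrals exist; without the two integrability
  premises the Bochner integral would silently be \<open>0\<close>.\<close>

definition displacement_monotone :: "'n::finite hamiltonian \<Rightarrow> bool" where
  "displacement_monotone K \<longleftrightarrow>
     (\<forall>\<mu>\<in>P2. C1 (\<lambda>(x, p). K x \<mu> p)) \<and>
     (\<forall>\<mu>\<in>P2. \<forall>\<nu>\<in>P2. \<forall>\<gamma>\<in>couplings \<mu> \<nu>. \<forall>p1\<in>bcontfun. \<forall>p2\<in>bcontfun.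
        integrable \<gamma> (\<lambda>(x, y). (Dx K x \<mu> (p1 x) - Dx K y \<nu> (p2 y)) \<bullet> (x - y)) \<longrightarrow>
        integrable \<gamma> (\<lambda>(x, y). (Dp K x \<mu> (p1 x) - Dp K y \<nu> (p2 y)) \<bullet> (p1 x - p2 y)) \<longrightarrow>
        - (\<integral>(x, y). (Dx K x \<mu> (p1 x) - Dx K y \<nu> (p2 y)) \<bullet> (x - y) \<partial>\<gamma>)
        + (\<integral>(x, y). (Dp K x \<mu> (p1 x) - Dp K y \<nu> (p2 y)) \<bullet> (p1 x - p2 y) \<partial>\<gamma>) \<ge> 0)"

definition shifted :: "real \<Rightarrow> 'n::finite hamiltonian \<Rightarrow> 'n hamiltonian" where
  "shifted \<alpha> H = (\<lambda>x \<mu> p. H x \<mu> (p - \<alpha> *\<^sub>R x))"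

end

theory Submission
  imports Defs
begin

text \<open>Substitute \<open>q\<^sup>1 = p\<^sup>1(x) - \<alpha> x\<close>, \<open>q\<^sup>2 = p\<^sup>2(y) - \<alpha> y\<close>, put \<open>d = x - y\<close>, \<open>e = q\<^sup>1 - q\<^sup>2\<close>, \<open>w = e + \<alpha> d\<close>, and let \<open>m\<close> be
  the mean of \<open>|d|\<close> under the coupling.  The integrand of the displacement functional is the increment of
  \<open>- \<partial>\<^sub>xH \<cdot> d + \<partial>\<^sub>pH \<cdot> (2\<alpha> d + e)\<close> from \<open>(y, \<nu>, q\<^sup>2)\<close> to \<open>(x, \<mu>, q\<^sup>1)\<close>, and it is bounded below
  pointwise by moving first the Euclidean variables and then the measure.  In the Euclidean step
  the symmetry of the Hessian cancels the term \<open>d \<cdot> \<partial>\<^sub>x\<^sub>pH e\<close>, on whose size nothing is assumed, and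
  leaves \<open>2\<alpha> d \<cdot> \<partial>\<^sub>x\<^sub>pH d - d \<cdot> \<partial>\<^sub>x\<^sub>xH d - \<alpha>\<^sup>2 d \<cdot> \<partial>\<^sub>p\<^sub>pH d + w \<cdot> \<partial>\<^sub>p\<^sub>pH w\<close>.  The measure step, along the
  segment between random variables realising the coupling, costs at most
  \<open>|\<partial>\<^sub>x\<^sub>\<mu>H| |d| m + |\<partial>\<^sub>p\<^sub>\<mu>H| (|w| + \<alpha> |d|) m\<close>.  The convexity term \<open>|w|\<^sup>2 / c\<^sub>0\<close> absorbs the part in \<open>|w|\<close>,
  and integration gives a multiple of the mean of \<open>|d|\<^sup>2\<close> whose factor is, up to sign, the quadratic polynomial with
  roots \<open>\<alpha>\<^sub>-\<close> and \<open>\<alpha>\<^sub>+\<close>.\<close>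

section \<open>Realising a law on the unit interval\<close>

text \<open>With digits 0 and 1 in base three, the positions after \<open>n\<close> add at most 1/2
  to the number scaled by \<open>3 ^ n\<close>, so the floor never sees a carry; base two would be
  ambiguous. Earlier positions contribute multiples of 3.\<close>

lemma ternary_digit:
  fixes a :: "nat \<Rightarrow> bool"
  shows "\<lfloor>3 ^ n * (\<Sum>k. of_bool (a k) / 3 ^ k :: real)\<rfloor> mod 3 = of_bool (a n)"
proof -
  let ?f = "\<lambda>k. of_bool (a k) / 3 ^ k :: real"
  have geo: "(\<lambda>k. (1/3) ^ k :: real) sums (3/2)"
    using geometric_sums[of "1/3::real"] by simp
  have sm: "summable ?f"
    by (rule summable_comparison_test'[OF sums_summable[OF geo], of 0]) (auto simp: power_one_over)
  define T where "T = (\<Sum>k. ?f (k + Suc n))"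
  have split: "(\<Sum>k. ?f k) = T + (\<Sum>k<Suc n. ?f k)"
    unfolding T_def by (rule suminf_split_initial_segment[OF sm])
  have smT: "summable (\<lambda>k. ?f (k + Suc n))" using sm by (rule summable_ignore_initial_segment)
  have T0: "0 \<le> T" unfolding T_def by (rule suminf_nonneg[OF smT]) auto
  have "T \<le> (\<Sum>k. (1/3) ^ k * (1 / 3 ^ Suc n))" unfolding T_def
    by (rule suminf_le[OF _ smT sums_summable[OF sums_mult2[OF geo]]])
       (auto simp: power_add field_simps)
  also have "\<dots> = 3/2 * (1 / 3 ^ Suc n)" by (rule sums_unique[OF sums_mult2[OF geo], symmetric])
  finally have T1: "3 ^ n * T \<le> 1/2" by (simp add: field_simps)
  define S where "S = (\<Sum>k<n. of_bool (a k) * 3 ^ (n - Suc k) :: int)"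
  have "3 ^ n * (\<Sum>k<Suc n. ?f k) = of_int (3 * S + of_bool (a n))"
  proof -
    have "3 ^ n * (\<Sum>k<n. ?f k) = (\<Sum>k<n. 3 * (of_bool (a k) * 3 ^ (n - Suc k)))"
      unfolding sum_distrib_left
    proof (rule sum.cong[OF refl])
      fix k assume "k \<in> {..<n}"
      then have "n = Suc (n - Suc k) + k" by auto
      then have "(3::real) ^ n = 3 * 3 ^ (n - Suc k) * 3 ^ k" by (metis power_Suc power_add)
      then show "3 ^ n * ?f k = 3 * (of_bool (a k) * 3 ^ (n - Suc k))" by simp
    qed
    moreover have "3 ^ n * (\<Sum>k<Suc n. ?f k) = 3 ^ n * (\<Sum>k<n. ?f k) + of_bool (a n)"
      by (simp add: distrib_left)
    ultimately show ?thesis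
      by (simp only: S_def sum_distrib_left of_int_add of_int_mult of_int_sum of_int_power
            of_int_of_bool of_int_numeral)
  qed
  then have "\<lfloor>3 ^ n * (\<Sum>k. ?f k)\<rfloor> = 3 * S + of_bool (a n)"
    using T0 T1 unfolding split distrib_left by (intro floor_unique) auto
  then show ?thesis by simp
qed

text \<open>A countable family of half-spaces separates the points of a Euclidean space; its membership
  bits, read as ternary digits, encode a point in a real number and can be decoded measurably.\<close>

lemma borel_encoding_real:
  obtains c :: "'a::euclidean_space \<Rightarrow> real" and d :: "real \<Rightarrow> 'a"
  where "c \<in> borel_measurable borel" "d \<in> borel_measurable borel" "\<And>z. d (c z) = z"
proof -
  \<comment> \<open>Each \<open>k\<close> codes a basis vector and a rational threshold; digit
    \<open>k\<close> of \<open>c z\<close> tells whether \<open>z\<close> lies in the corresponding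
    open half-space.\<close>
  define B where "B k = from_nat_into (Basis :: 'a set) (fst (prod_decode k))" for k
  define q where "q k = real_of_rat (from_nat (snd (prod_decode k)))" for k
  define c where "c z = (\<Sum>k. of_bool (q k < z \<bullet> B k) / 3 ^ k :: real)" for z :: 'a
  \<comment> \<open>A coordinate is the supremum of the rationals below it. Indices with another
    basis vector or with digit 0 enter as \<open>-\<infinity>\<close> and leave the supremum
    unchanged.\<close>
  define d where "d r = (\<Sum>b\<in>Basis. real_of_ereal
      (SUP k. if B k = b \<and> \<lfloor>3 ^ k * r\<rfloor> mod 3 = (1::int) then ereal (q k) else -\<infinity>) *\<^sub>R b)" for r :: real
  have m1: "c \<in> borel_measurable borel"
  proof -
    have "(\<lambda>z. of_bool (q k < z \<bullet> B k) / 3 ^ k :: real) \<in> borel_measurable borel" for k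
      unfolding of_bool_def by measurable
    then show ?thesis unfolding c_def by measurable
  qed
  have m2: "d \<in> borel_measurable borel"
  proof -
    have "(\<lambda>r::real. (SUP k. if B k = b \<and> \<lfloor>3 ^ k * r\<rfloor> mod 3 = (1::int) then ereal (q k) else -\<infinity>))
       \<in> borel_measurable borel" for b
    proof (rule borel_measurable_SUP)
      fix k
      show "(\<lambda>r::real. if B k = b \<and> \<lfloor>3 ^ k * r\<rfloor> mod 3 = (1::int) then ereal (q k) else -\<infinity>)
        \<in> borel_measurable borel"
        by (cases "B k = b") simp_all
    qed simp
    then show ?thesis unfolding d_def by measurable
  qed
  have "d (c z) = z" for z
  proof -
    have "(SUP k. if B k = b \<and> \<lfloor>3 ^ k * c z\<rfloor> mod 3 = (1::int) then ereal (q k) else -\<infinity>) = ereal (z \<bullet> b)"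
      (is "(SUP k. ?g k) = _") if b: "b \<in> Basis" for b
    proof (rule SUP_eqI)
      fix k :: nat
      show "?g k \<le> ereal (z \<bullet> b)"
        unfolding c_def ternary_digit by (auto split: if_splits)
    next
      fix y assume y: "\<And>k. k \<in> UNIV \<Longrightarrow> ?g k \<le> y"
      show "ereal (z \<bullet> b) \<le> y"
      proof (rule ccontr)
        assume "\<not> ?thesis"
        \<comment> \<open>The bound \<open>y\<close> may be \<open>-\<infinity>\<close>, so a real
          \<open>x\<close> is inserted before a rational threshold is sought.\<close>
        then obtain x where x: "y < ereal x" "x < z \<bullet> b"
          by (metis ereal_dense2 ereal_less_eq(3) less_ereal.simps(1) linorder_not_less)
        obtain r where r: "x < real_of_rat r" "real_of_rat r < z \<bullet> b"
          using of_rat_dense[OF x(2)] by auto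
        obtain i where i: "from_nat_into (Basis :: 'a set) i = b"
          using b by (metis countable_finite finite_Basis from_nat_into_surj)
        define k where "k = prod_encode (i, to_nat r)"
        have Bk: "B k = b" and qk: "q k = real_of_rat r" by (simp_all add: B_def q_def k_def i)
        have "?g k = ereal (q k)" unfolding c_def ternary_digit using r Bk qk by simp
        with y[of k] have "ereal (q k) \<le> y" by simp
        then have "ereal (q k) < ereal x" using x(1) by (rule le_less_trans)
        then show False using r(1) qk by simp
      qed
    qed
    then show ?thesis unfolding d_def by (simp add: euclidean_representation)
  qed
  then show ?thesis using that m1 m2 by blast
qed

text \<open>The law is encoded on the real line, realised there by the quantile function
  \<open>N.I\<close> under the uniform law, and decoded again. Applied to a coupling, this puts both
  marginals on \<open>Omega\<close> with the prescribed joint law.\<close>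

lemma ex_random_variable_Omega:
  fixes M :: "'a::euclidean_space measure"
  assumes "prob_space M" and M: "sets M = sets borel"
  obtains X where "X \<in> borel_measurable Omega" "distr Omega borel X = M"
proof -
  obtain c :: "'a \<Rightarrow> real" and d where [measurable]: "c \<in> borel_measurable borel" "d \<in> borel_measurable borel"
    and dc: "\<And>z. d (c z) = z" using borel_encoding_real by blast
  interpret prob_space M by fact
  have cM[measurable]: "c \<in> borel_measurable M" using M by (simp cong: measurable_cong_sets)
  interpret N: cdf_distribution "distr M borel c"
    unfolding cdf_distribution_def by (rule real_distribution_distr) simp
  let ?I = "N.I"
  have I[measurable]: "?I \<in> borel_measurable Omega"
    using N.measurable_CI unfolding Omega_def
    by (subst measurable_cong_sets[OF sets_restrict_space_cong[OF sets_lborel] refl])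
  show ?thesis
  proof
    show "d \<circ> ?I \<in> borel_measurable Omega" using I by simp
    have "distr Omega borel (d \<circ> ?I) = distr (distr Omega borel ?I) borel d"
      by (subst distr_distr) auto
    also have "distr Omega borel ?I = distr M borel c"
      unfolding Omega_def by (rule N.distr_I_eq_M)
    also have "distr (distr M borel c) borel d = distr M borel (d \<circ> c)"
      by (subst distr_distr) auto
    also have "\<dots> = M" using dc M by (simp add: comp_def distr_id2)
    finally show "distr Omega borel (d \<circ> ?I) = M" .
  qed
qed

section \<open>Mean value estimates along a coupling\<close>

lemma prob_space_Omega: "prob_space Omega"
  unfolding Omega_def
  by (auto simp add: emeasure_restrict_space space_restrict_space intro!: prob_spaceI)

lemma norm_add_squared_le:
  fixes x y :: "'a::real_normed_vector"
  shows "(norm (x + y))\<^sup>2 \<le> 2 * (norm x)\<^sup>2 + 2 * (norm y)\<^sup>2"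
proof -
  have "(norm (x + y))\<^sup>2 \<le> (norm x + norm y)\<^sup>2"
    by (intro power_mono norm_triangle_ineq) simp
  also have "\<dots> \<le> 2 * (norm x)\<^sup>2 + 2 * (norm y)\<^sup>2"
    using sum_squares_bound[of "norm x" "norm y"] by (simp add: power2_sum)
  finally show ?thesis .
qed

lemma L2_add: "\<xi> \<in> L2 \<Longrightarrow> \<eta> \<in> L2 \<Longrightarrow> (\<lambda>\<omega>. \<xi> \<omega> + \<eta> \<omega>) \<in> L2"
proof -
  assume \<xi>: "\<xi> \<in> L2" and \<eta>: "\<eta> \<in> L2"
  have [measurable]: "\<xi> \<in> borel_measurable Omega" "\<eta> \<in> borel_measurable Omega"
    using \<xi> \<eta> by (auto simp: L2_def)
  have "integrable Omega (\<lambda>\<omega>. (norm (\<xi> \<omega> + \<eta> \<omega>))\<^sup>2)"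
  proof (rule Bochner_Integration.integrable_bound)
    show "integrable Omega (\<lambda>\<omega>. 2 * (norm (\<xi> \<omega>))\<^sup>2 + 2 * (norm (\<eta> \<omega>))\<^sup>2)"
      using \<xi> \<eta> by (auto simp: L2_def)
    show "AE \<omega> in Omega. norm ((norm (\<xi> \<omega> + \<eta> \<omega>))\<^sup>2) \<le> norm (2 * (norm (\<xi> \<omega>))\<^sup>2 + 2 * (norm (\<eta> \<omega>))\<^sup>2)"
      by (simp add: norm_add_squared_le)
  qed measurable
  then show ?thesis by (simp add: L2_def)
qed

lemma L2_scaleR: "\<xi> \<in> L2 \<Longrightarrow> (\<lambda>\<omega>. h *\<^sub>R \<xi> \<omega>) \<in> L2"
  by (auto simp: L2_def power_mult_distrib)

lemma L2norm_scaleR: "L2norm (\<lambda>\<omega>. h *\<^sub>R \<xi> \<omega>) = \<bar>h\<bar> * L2norm \<xi>"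
  by (simp add: L2norm_def power_mult_distrib real_sqrt_mult)

lemma integrable_inner_L2:
  assumes "\<xi> \<in> L2" "\<eta> \<in> L2"
  shows "integrable Omega (\<lambda>\<omega>. \<xi> \<omega> \<bullet> \<eta> \<omega>)"
proof (rule Bochner_Integration.integrable_bound)
  have [measurable]: "\<xi> \<in> borel_measurable Omega" "\<eta> \<in> borel_measurable Omega"
    using assms by (auto simp: L2_def)
  show "integrable Omega (\<lambda>\<omega>. (norm (\<xi> \<omega>))\<^sup>2 + (norm (\<eta> \<omega>))\<^sup>2)"
    using assms by (auto simp: L2_def)
  show "(\<lambda>\<omega>. \<xi> \<omega> \<bullet> \<eta> \<omega>) \<in> borel_measurable Omega" by measurable
  have "\<bar>x \<bullet> y\<bar> \<le> (norm x)\<^sup>2 + (norm y)\<^sup>2" for x y :: 'a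
    using Cauchy_Schwarz_ineq2[of x y] sum_squares_bound[of "norm x" "norm y"]
      mult_nonneg_nonneg[of "norm x" "norm y"] by simp
  then show "AE \<omega> in Omega. norm (\<xi> \<omega> \<bullet> \<eta> \<omega>) \<le> norm ((norm (\<xi> \<omega>))\<^sup>2 + (norm (\<eta> \<omega>))\<^sup>2)"
    by simp
qed

lemma integrable_norm_L2: "\<xi> \<in> L2 \<Longrightarrow> integrable Omega (\<lambda>\<omega>. norm (\<xi> \<omega>))"
proof -
  assume \<xi>: "\<xi> \<in> L2"
  interpret prob_space Omega by (rule prob_space_Omega)
  have [measurable]: "\<xi> \<in> borel_measurable Omega" using \<xi> by (auto simp: L2_def)
  show ?thesis
    by (rule square_integrable_imp_integrable) (use \<xi> in \<open>auto simp: L2_def\<close>)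
qed

lemma Law_L2_in_P2:
  assumes "\<xi> \<in> L2" shows "Law \<xi> \<in> P2"
proof -
  have [measurable]: "\<xi> \<in> borel_measurable Omega" using assms by (auto simp: L2_def)
  interpret prob_space Omega by (rule prob_space_Omega)
  show ?thesis using assms unfolding P2_def Law_def L2_def
    by (auto intro!: prob_space_distr simp: integrable_distr_eq)
qed

text \<open>The Frechet estimate at the moved point \<open>\<zeta>\<close>, tested on the increments
  \<open>h *\<^sub>R \<eta> \<omega>\<close>, is an estimate of the difference quotient.\<close>

lemma wasserstein_gradient_DERIV:
  assumes "is_wasserstein_gradient U D" "\<xi> \<in> L2" "\<eta> \<in> L2"
  shows "((\<lambda>t. U (Law (\<lambda>\<omega>. \<xi> \<omega> + t *\<^sub>R \<eta> \<omega>))) has_real_derivative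
    (\<integral>\<omega>. D (Law (\<lambda>\<omega>. \<xi> \<omega> + t *\<^sub>R \<eta> \<omega>)) (\<xi> \<omega> + t *\<^sub>R \<eta> \<omega>) \<bullet> \<eta> \<omega> \<partial>Omega)) (at t)"
proof -
  define \<zeta> where "\<zeta> = (\<lambda>\<omega>. \<xi> \<omega> + t *\<^sub>R \<eta> \<omega>)"
  have \<zeta>: "\<zeta> \<in> L2" unfolding \<zeta>_def using assms by (intro L2_add L2_scaleR)
  define u where "u s = U (Law (\<lambda>\<omega>. \<xi> \<omega> + s *\<^sub>R \<eta> \<omega>))" for s
  define I where "I = (\<integral>\<omega>. D (Law \<zeta>) (\<zeta> \<omega>) \<bullet> \<eta> \<omega> \<partial>Omega)"
  define N where "N = L2norm \<eta>"
  have N: "0 \<le> N" by (simp add: N_def L2norm_def)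
  have "(\<lambda>h. (u (t + h) - u t) / h) \<midarrow>0\<rightarrow> I"
    unfolding LIM_eq
  proof (intro allI impI)
    fix r :: real assume r: "0 < r"
    \<comment> \<open>\<open>N + 1\<close> in place of \<open>N\<close> keeps the denominator
      positive when \<eta> has norm zero, here and in the radius below.\<close>
    define e where "e = r / (N + 1) / 2"
    have "r * N < r * (2 * (N + 1))" using r N by (intro mult_strict_left_mono) auto
    then have e: "0 < e" "e * N < r" using r N by (simp_all add: e_def divide_less_eq mult_ac)
    obtain \<delta> where \<delta>: "\<delta> > 0" and *: "\<And>\<theta>. \<theta> \<in> L2 \<Longrightarrow> L2norm \<theta> < \<delta> \<Longrightarrow>
        \<bar>U (Law (\<lambda>\<omega>. \<zeta> \<omega> + \<theta> \<omega>)) - U (Law \<zeta>) - (\<integral>\<omega>. D (Law \<zeta>) (\<zeta> \<omega>) \<bullet> \<theta> \<omega> \<partial>Omega)\<bar> \<le> e * L2norm \<theta>"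
      using assms(1) \<zeta> e unfolding is_wasserstein_gradient_def by meson
    show "\<exists>s>0. \<forall>x. x \<noteq> 0 \<and> norm (x - 0) < s \<longrightarrow> norm ((u (t + x) - u t) / x - I) < r"
    proof (intro exI conjI allI impI)
      show "0 < \<delta> / (N + 1)" using \<delta> N by simp
      fix h :: real assume h: "h \<noteq> 0 \<and> norm (h - 0) < \<delta> / (N + 1)"
      then have "\<bar>h\<bar> * (N + 1) < \<delta>" using N by (simp add: field_simps)
      then have small: "\<bar>h\<bar> * N < \<delta>" using h N by (simp add: distrib_left)
      have "\<bar>U (Law (\<lambda>\<omega>. \<zeta> \<omega> + h *\<^sub>R \<eta> \<omega>)) - U (Law \<zeta>) - h * I\<bar> \<le> e * (\<bar>h\<bar> * N)"
        using *[of "\<lambda>\<omega>. h *\<^sub>R \<eta> \<omega>"] small L2_scaleR[OF assms(3)]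
        by (simp add: L2norm_scaleR N_def I_def)
      moreover have "U (Law (\<lambda>\<omega>. \<zeta> \<omega> + h *\<^sub>R \<eta> \<omega>)) = u (t + h)" "U (Law \<zeta>) = u t"
        by (simp_all add: u_def \<zeta>_def algebra_simps)
      ultimately have "\<bar>u (t + h) - u t - h * I\<bar> \<le> \<bar>h\<bar> * (e * N)" by (simp add: mult_ac)
      moreover have "u (t + h) - u t - h * I = h * ((u (t + h) - u t) / h - I)"
        using h by (simp add: field_simps)
      ultimately have "\<bar>h\<bar> * \<bar>(u (t + h) - u t) / h - I\<bar> \<le> \<bar>h\<bar> * (e * N)"
        by (simp only: abs_mult)
      then have "\<bar>(u (t + h) - u t) / h - I\<bar> \<le> e * N" using h by simp
      then show "norm ((u (t + h) - u t) / h - I) < r" using e by simp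
    qed
  qed
  then show ?thesis unfolding DERIV_def u_def I_def \<zeta>_def .
qed

text \<open>The components are combined with the weights \<open>v\<close> before the mean value
  theorem is used: one intermediate \<open>t\<close> then serves them all, and \<open>C\<close> can
  come from an operator norm instead of a sum over rows.\<close>

lemma wasserstein_gradients_mvt:
  fixes U :: "'n::finite \<Rightarrow> 'a::euclidean_space measure \<Rightarrow> real"
  assumes grad: "\<And>i. is_wasserstein_gradient (U i) (D i)"
    and bound: "\<And>\<mu> z. \<mu> \<in> P2 \<Longrightarrow> norm (\<Sum>i\<in>UNIV. v i *\<^sub>R D i \<mu> z) \<le> C"
    and L2: "\<xi> \<in> L2" "\<eta> \<in> L2"
  shows "\<bar>(\<Sum>i\<in>UNIV. v i * (U i (Law (\<lambda>\<omega>. \<xi> \<omega> + \<eta> \<omega>)) - U i (Law \<xi>)))\<bar>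
    \<le> C * (\<integral>\<omega>. norm (\<eta> \<omega>) \<partial>Omega)"
proof -
  define \<zeta> where "\<zeta> t = (\<lambda>\<omega>. \<xi> \<omega> + t *\<^sub>R \<eta> \<omega>)" for t
  have \<zeta>: "\<zeta> t \<in> L2" for t unfolding \<zeta>_def using L2 by (intro L2_add L2_scaleR)
  define I where "I t i = (\<integral>\<omega>. D i (Law (\<zeta> t)) (\<zeta> t \<omega>) \<bullet> \<eta> \<omega> \<partial>Omega)" for t i
  define f where "f t = (\<Sum>i\<in>UNIV. v i * U i (Law (\<zeta> t)))" for t
  have der: "(f has_real_derivative (\<Sum>i\<in>UNIV. v i * I t i)) (at t)" for t
    unfolding f_def I_def \<zeta>_def
    by (intro DERIV_sum DERIV_cmult wasserstein_gradient_DERIV grad L2)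
  obtain t where t: "f 1 - f 0 = (1 - 0) * (\<Sum>i\<in>UNIV. v i * I t i)"
    using MVT2[of 0 1 f, OF _ der] by auto
  have DL2: "(\<lambda>\<omega>. D i (Law (\<zeta> t)) (\<zeta> t \<omega>)) \<in> L2" for i
    using grad \<zeta> unfolding is_wasserstein_gradient_def by blast
  have int: "integrable Omega (\<lambda>\<omega>. D i (Law (\<zeta> t)) (\<zeta> t \<omega>) \<bullet> \<eta> \<omega>)" for i
    by (rule integrable_inner_L2[OF DL2 L2(2)])
  let ?g = "\<lambda>\<omega>. (\<Sum>i\<in>UNIV. v i *\<^sub>R D i (Law (\<zeta> t)) (\<zeta> t \<omega>)) \<bullet> \<eta> \<omega>"
  have "(\<Sum>i\<in>UNIV. v i * I t i) = (\<integral>\<omega>. (\<Sum>i\<in>UNIV. v i * (D i (Law (\<zeta> t)) (\<zeta> t \<omega>) \<bullet> \<eta> \<omega>)) \<partial>Omega)"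
    unfolding I_def using int by (subst Bochner_Integration.integral_sum) auto
  also have "\<dots> = integral\<^sup>L Omega ?g" by (simp add: inner_sum_left)
  finally have eq: "f 1 - f 0 = integral\<^sup>L Omega ?g" using t by simp
  have "integrable Omega ?g" using int by (simp add: inner_sum_left)
  then have "norm (integral\<^sup>L Omega ?g) \<le> (\<integral>\<omega>. C * norm (\<eta> \<omega>) \<partial>Omega)"
  proof (rule Bochner_Integration.integral_norm_bound_integral)
    show "integrable Omega (\<lambda>\<omega>. C * norm (\<eta> \<omega>))" using integrable_norm_L2[OF L2(2)] by simp
    fix \<omega>
    have "norm (?g \<omega>) \<le> norm (\<Sum>i\<in>UNIV. v i *\<^sub>R D i (Law (\<zeta> t)) (\<zeta> t \<omega>)) * norm (\<eta> \<omega>)"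
      using Cauchy_Schwarz_ineq2 by simp
    also have "\<dots> \<le> C * norm (\<eta> \<omega>)"
      by (intro mult_right_mono bound Law_L2_in_P2 \<zeta>) simp
    finally show "norm (?g \<omega>) \<le> C * norm (\<eta> \<omega>)" .
  qed
  moreover have "f 1 - f 0 = (\<Sum>i\<in>UNIV. v i * (U i (Law (\<lambda>\<omega>. \<xi> \<omega> + \<eta> \<omega>)) - U i (Law \<xi>)))"
    by (simp add: f_def \<zeta>_def right_diff_distrib sum_subtractf)
  ultimately show ?thesis using eq by simp
qed

lemma coupling_square_integrable:
  assumes "\<mu> \<in> P2" "\<nu> \<in> P2" "\<gamma> \<in> couplings \<mu> \<nu>"
  shows "integrable \<gamma> (\<lambda>z. (norm (fst z))\<^sup>2)" "integrable \<gamma> (\<lambda>z. (norm (snd z))\<^sup>2)"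
proof -
  have sets: "sets \<gamma> = sets borel" and eq: "distr \<gamma> borel fst = \<mu>" "distr \<gamma> borel snd = \<nu>"
    using assms by (auto simp: couplings_def)
  have [measurable]: "fst \<in> borel_measurable \<gamma>" "snd \<in> borel_measurable \<gamma>"
    by (simp_all add: measurable_cong_sets[OF sets refl] borel_prod[symmetric])
  show "integrable \<gamma> (\<lambda>z. (norm (fst z))\<^sup>2)" "integrable \<gamma> (\<lambda>z. (norm (snd z))\<^sup>2)"
    using assms unfolding P2_def eq[symmetric] by (simp_all add: integrable_distr_eq)
qed

text \<open>An arbitrary coupling, optimal or not, is realised by two random variables on
  \<open>Omega\<close>. The segment between them joins \<nu> to \<mu>, and its increment has the
  mean length given by the coupling.\<close>

lemma coupling_wasserstein_gradients_mvt:
  fixes U :: "'n::finite \<Rightarrow> 'a::euclidean_space measure \<Rightarrow> real"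
  assumes grad: "\<And>i. is_wasserstein_gradient (U i) (D i)"
    and bound: "\<And>\<mu> z. \<mu> \<in> P2 \<Longrightarrow> norm (\<Sum>i\<in>UNIV. v i *\<^sub>R D i \<mu> z) \<le> C"
    and \<mu>\<nu>: "\<mu> \<in> P2" "\<nu> \<in> P2" "\<gamma> \<in> couplings \<mu> \<nu>"
  shows "\<bar>(\<Sum>i\<in>UNIV. v i * (U i \<mu> - U i \<nu>))\<bar> \<le> C * (\<integral>z. norm (fst z - snd z) \<partial>\<gamma>)"
proof -
  have sets: "sets \<gamma> = sets borel" and \<gamma>: "prob_space \<gamma>"
    and eq: "distr \<gamma> borel fst = \<mu>" "distr \<gamma> borel snd = \<nu>"
    using \<mu>\<nu> by (auto simp: couplings_def)
  have [measurable]: "fst \<in> borel_measurable (borel :: ('a \<times> 'a) measure)"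
      "snd \<in> borel_measurable (borel :: ('a \<times> 'a) measure)"
    by (simp_all add: borel_prod[symmetric])
  obtain Z where Z[measurable]: "Z \<in> borel_measurable Omega" and dZ: "distr Omega borel Z = \<gamma>"
    by (rule ex_random_variable_Omega[OF \<gamma> sets])
  have sq: "integrable Omega (\<lambda>\<omega>. (norm (fst (Z \<omega>)))\<^sup>2)" "integrable Omega (\<lambda>\<omega>. (norm (snd (Z \<omega>)))\<^sup>2)"
    using coupling_square_integrable[OF \<mu>\<nu>] unfolding dZ[symmetric]
    by (simp_all add: integrable_distr_eq)
  define \<xi> where "\<xi> \<omega> = snd (Z \<omega>)" for \<omega>
  define \<eta> where "\<eta> \<omega> = fst (Z \<omega>) + (-1) *\<^sub>R snd (Z \<omega>)" for \<omega>
  have f: "(\<lambda>\<omega>. fst (Z \<omega>)) \<in> L2" and s: "(\<lambda>\<omega>. snd (Z \<omega>)) \<in> L2" using sq by (auto simp: L2_def)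
  have L2: "\<xi> \<in> L2" "\<eta> \<in> L2"
    unfolding \<xi>_def \<eta>_def by (intro s L2_add[OF f L2_scaleR[OF s]])+
  have "Law \<xi> = distr (distr Omega borel Z) borel snd"
    by (subst distr_distr) (auto simp: Law_def \<xi>_def[abs_def] comp_def)
  then have 1: "Law \<xi> = \<nu>" by (simp add: dZ eq)
  have "Law (\<lambda>\<omega>. \<xi> \<omega> + \<eta> \<omega>) = distr (distr Omega borel Z) borel fst"
    by (subst distr_distr) (auto simp: Law_def \<xi>_def[abs_def] \<eta>_def[abs_def] comp_def)
  then have 2: "Law (\<lambda>\<omega>. \<xi> \<omega> + \<eta> \<omega>) = \<mu>" by (simp add: dZ eq)
  have 3: "(\<integral>z. norm (fst z - snd z) \<partial>\<gamma>) = (\<integral>\<omega>. norm (\<eta> \<omega>) \<partial>Omega)"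
    unfolding dZ[symmetric] by (subst integral_distr) (auto simp: \<eta>_def)
  show ?thesis
    using wasserstein_gradients_mvt[OF grad bound L2] unfolding 1 2 3 by simp
qed

section \<open>Matrices and second derivatives\<close>

text \<open>At \<open>u + s *\<^sub>R h\<close> with \<open>h = B *v u\<close> the form has no
  constant term and the linear coefficient \<open>2 * (h \<bullet> h)\<close>; if \<open>h\<close>
  were nonzero, a small negative \<open>s\<close> would make the form negative.\<close>

lemma psd_quadratic_form_zero:
  fixes B :: "real^'n^'n"
  assumes sym: "\<And>u v. u \<bullet> (B *v v) = v \<bullet> (B *v u)"
    and psd: "\<And>v. 0 \<le> v \<bullet> (B *v v)" and u: "u \<bullet> (B *v u) = 0"
  shows "B *v u = 0"
proof (rule ccontr)
  assume "B *v u \<noteq> 0"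
  define h where "h = B *v u"
  define a where "a = h \<bullet> h"
  define c where "c = h \<bullet> (B *v h)"
  \<comment> \<open>With \<open>s = - r\<close> the form takes the value
    \<open>- (r\<^sup>2 * (c + 2))\<close>; the summand 1 covers \<open>c = 0\<close>.\<close>
  define r where "r = a / (c + 1)"
  define s where "s = - r"
  have a: "a > 0" using \<open>B *v u \<noteq> 0\<close> by (simp add: a_def h_def)
  have c: "c \<ge> 0" unfolding c_def by (rule psd)
  have r: "r > 0" and a_eq: "a = r * (c + 1)" using a c by (simp_all add: r_def)
  have "0 \<le> (u + s *\<^sub>R h) \<bullet> (B *v (u + s *\<^sub>R h))" by (rule psd)
  also have "\<dots> = 2 * s * a + s\<^sup>2 * c"
    using sym[of u h] u
    by (simp add: matrix_vector_right_distrib matrix_vector_mult_scaleR inner_add_left inner_add_right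
        a_def c_def power2_eq_square distrib_left flip: h_def)
  also have "\<dots> = - (r\<^sup>2 * (c + 2))"
    unfolding a_eq s_def by (simp add: power2_eq_square algebra_simps)
  also have "\<dots> < 0" using r c by simp
  finally show False by simp
qed

lemma mat_mult_vector: "mat m *v w = m *\<^sub>R (w :: real^'n)"
  by (simp add: vec_eq_iff matrix_vector_mult_def mat_def if_distrib if_distribR sum.delta cong: if_cong)

text \<open>A minimiser \<open>u\<close> of the form on the unit sphere exists by compactness. The
  form of \<open>A - mat m\<close> is nonnegative and vanishes at \<open>u\<close>, so
  \<open>u\<close> is an eigenvector for the minimum \<open>m\<close>, and this is what gives the
  \<open>LEAST\<close> in \<open>lambda_min\<close> its meaning.\<close>

lemma lambda_min_le_quadratic_form:
  fixes A :: "real^'n^'n"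
  assumes A: "transpose A = A"
  shows "lambda_min A * (v \<bullet> v) \<le> v \<bullet> (A *v v)"
proof -
  have symA: "u \<bullet> (A *v w) = w \<bullet> (A *v u)" for u w
    using A by (metis dot_lmul_matrix inner_commute vector_transpose_matrix)
  have "continuous_on (sphere 0 1) (\<lambda>v::real^'n. v \<bullet> (A *v v))"
    by (intro continuous_intros linear_continuous_on_compose matrix_vector_mul_linear)
  from continuous_attains_inf[OF compact_sphere _ this]
  obtain u where "u \<in> sphere 0 1" "\<forall>v\<in>sphere 0 1. u \<bullet> (A *v u) \<le> v \<bullet> (A *v v)" by auto
  then have u: "norm u = 1" and min: "\<And>v. norm v = 1 \<Longrightarrow> u \<bullet> (A *v u) \<le> v \<bullet> (A *v v)"
    by auto
  define m where "m = u \<bullet> (A *v u)"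
  have low: "m * (v \<bullet> v) \<le> v \<bullet> (A *v v)" for v
  proof (cases "v = 0")
    case False
    have "m \<le> (v /\<^sub>R norm v) \<bullet> (A *v (v /\<^sub>R norm v))"
      unfolding m_def using False by (intro min) simp
    also have "\<dots> = (v \<bullet> (A *v v)) / (v \<bullet> v)"
      by (simp add: matrix_vector_mult_scaleR dot_square_norm power2_eq_square divide_inverse mult_ac)
    finally show ?thesis using False by (simp add: pos_le_divide_eq)
  qed simp
  have B: "(A - mat m) *v w = A *v w - m *\<^sub>R w" for w
    by (simp add: matrix_vector_mult_diff_rdistrib mat_mult_vector)
  have "(A - mat m) *v u = 0"
  proof (rule psd_quadratic_form_zero)
    show "x \<bullet> ((A - mat m) *v w) = w \<bullet> ((A - mat m) *v x)" for x w
      unfolding B using symA[of x w] by (simp add: inner_diff_right inner_commute)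
    show "0 \<le> w \<bullet> ((A - mat m) *v w)" for w
      unfolding B using low[of w] by (simp add: inner_diff_right)
    show "u \<bullet> ((A - mat m) *v u) = 0"
      unfolding B using u by (simp add: inner_diff_right m_def dot_square_norm)
  qed
  then have "A *v u = m *\<^sub>R u" unfolding B by simp
  then have "lambda_min A = m"
    unfolding lambda_min_def
  proof (intro Least_equality exI[of _ u] conjI)
    show "u \<noteq> 0" using u by auto
    fix l assume "\<exists>w. w \<noteq> 0 \<and> A *v w = l *\<^sub>R w"
    then obtain w where "w \<noteq> 0" "A *v w = l *\<^sub>R w" by blast
    then show "m \<le> l" using low[of w] by simp
  qed
  then show ?thesis using low by simp
qed

text \<open>The antisymmetric part of a matrix contributes nothing to its quadratic form.\<close>

lemma lambda_min_Re_mat_le: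
  fixes A :: "real^'n^'n"
  shows "lambda_min (Re_mat A) * (v \<bullet> v) \<le> v \<bullet> (A *v v)"
proof -
  have "transpose (Re_mat A) = Re_mat A"
    by (simp add: Re_mat_def transpose_def vec_eq_iff)
  then have "lambda_min (Re_mat A) * (v \<bullet> v) \<le> v \<bullet> (Re_mat A *v v)"
    by (rule lambda_min_le_quadratic_form)
  also have "v \<bullet> (transpose A *v v) = v \<bullet> (A *v v)"
    by (metis dot_lmul_matrix inner_commute vector_transpose_matrix)
  then have "v \<bullet> (Re_mat A *v v) = v \<bullet> (A *v v)"
    by (simp add: Re_mat_def matrix_vector_mult_add_rdistrib inner_add_right
        flip: scaleR_matrix_vector_assoc)
  finally show ?thesis .
qed

lemma norm_matrix_vector_le_norm_2: "norm (A *v v) \<le> norm_2 A * norm v"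
  unfolding norm_2_def by (rule onorm) (rule matrix_vector_mul_bounded_linear)

lemma norm_2_nonneg: "0 \<le> norm_2 A"
  unfolding norm_2_def by (rule onorm_pos_le) (rule matrix_vector_mul_bounded_linear)

text \<open>The combination is the transpose of \<open>A\<close> applied to \<open>v\<close>;
  pairing it with itself moves \<open>A\<close> to the other factor. Rows matter because those of
  \<open>Dxmu\<close> and \<open>Dpmu\<close> are Wasserstein gradients of single
  components.\<close>

lemma norm_row_combination_le_norm_2:
  fixes A :: "real^'n^'n"
  shows "norm (\<Sum>i\<in>UNIV. v $ i *\<^sub>R A $ i) \<le> norm_2 A * norm v"
proof -
  define r where "r = (\<Sum>i\<in>UNIV. v $ i *\<^sub>R A $ i)"
  have "r \<bullet> r = (\<Sum>i\<in>UNIV. v $ i *\<^sub>R A $ i) \<bullet> r" by (simp flip: r_def)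
  also have "\<dots> = v \<bullet> (A *v r)"
    by (simp add: inner_sum_left inner_vec_def[of v] matrix_mult_dot)
  also have "\<dots> \<le> norm v * norm (A *v r)" by (rule norm_cauchy_schwarz)
  also have "\<dots> \<le> norm v * (norm_2 A * norm r)"
    by (intro mult_left_mono norm_matrix_vector_le_norm_2) simp
  finally have "norm r * norm r \<le> (norm_2 A * norm v) * norm r"
    by (simp add: dot_square_norm power2_eq_square mult_ac)
  then show ?thesis unfolding r_def[symmetric]
    by (cases "r = 0") (auto simp: norm_2_nonneg)
qed

section \<open>Gradients and the symmetry of second derivatives\<close>

lemma GDERIV_grad: "f differentiable at x \<Longrightarrow> GDERIV f x :> grad f x"
proof -
  assume "f differentiable at x"
  then obtain f' where f': "(f has_derivative f') (at x)" unfolding differentiable_def by blast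
  interpret bounded_linear f' using f' by (rule has_derivative_bounded_linear)
  \<comment> \<open>The Riesz representative of \<open>f'\<close> is read off on the orthonormal
    basis. As \<open>grad\<close> is a definite description, uniqueness follows below.\<close>
  have "f' h = h \<bullet> (\<Sum>b\<in>Basis. f' b *\<^sub>R b)" for h
  proof -
    have "f' h = f' (\<Sum>b\<in>Basis. (h \<bullet> b) *\<^sub>R b)" by (simp add: euclidean_representation)
    also have "\<dots> = h \<bullet> (\<Sum>b\<in>Basis. f' b *\<^sub>R b)" by (simp add: sum scaleR inner_sum_right mult_ac)
    finally show ?thesis .
  qed
  then have "f' = (\<lambda>h. h \<bullet> (\<Sum>b\<in>Basis. f' b *\<^sub>R b))" by blast
  then have "GDERIV f x :> (\<Sum>b\<in>Basis. f' b *\<^sub>R b)"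
    using f' unfolding gderiv_def by simp
  moreover have "D = D'" if "GDERIV f x :> D" "GDERIV f x :> D'" for D D'
  proof -
    have "(\<lambda>h. h \<bullet> D) = (\<lambda>h. h \<bullet> D')"
      using that unfolding gderiv_def by (rule has_derivative_unique)
    then show ?thesis by (metis inner_commute vector_eq_ldot)
  qed
  ultimately show ?thesis unfolding grad_def by (metis (mono_tags, lifting) theI)
qed

lemma grad_eqI: "GDERIV f x :> D \<Longrightarrow> grad f x = D"
proof -
  assume D: "GDERIV f x :> D"
  then have "GDERIV f x :> grad f x"
    by (intro GDERIV_grad) (auto simp: gderiv_def differentiable_def)
  with D have "(\<lambda>h. h \<bullet> D) = (\<lambda>h. h \<bullet> grad f x)"
    unfolding gderiv_def by (rule has_derivative_unique)
  then show ?thesis by (metis inner_commute vector_eq_ldot)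
qed

text \<open>The mean value theorem in direction \<open>v\<close> turns the second difference into
  one increment of \<open>g\<close> between two points within \<open>s * K\<close> of
  \<open>e\<close>. Their offsets differ by \<open>s *\<^sub>R u\<close>, so linearising at
  \<open>e\<close> leaves the term in \<open>g' u\<close>.\<close>

lemma second_difference_estimate:
  fixes f :: "'a::real_inner \<Rightarrow> real"
  assumes f: "\<And>x. GDERIV f x :> g x"
    and est: "\<And>h. norm h < \<delta> \<Longrightarrow> norm (g (e + h) - g e - g' h) \<le> \<epsilon> * norm h"
    and "linear g'" "0 \<le> \<epsilon>" "0 < s" "s * K < \<delta>" and K: "norm u + norm v \<le> K"
  shows "\<bar>f (e + s *\<^sub>R u + s *\<^sub>R v) - f (e + s *\<^sub>R u) - f (e + s *\<^sub>R v) + f e - s\<^sup>2 * (v \<bullet> g' u)\<bar>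
    \<le> s\<^sup>2 * (2 * \<epsilon> * K\<^sup>2)"
proof -
  interpret linear g' by fact
  define \<phi> where "\<phi> t = f (e + s *\<^sub>R u + t *\<^sub>R v) - f (e + t *\<^sub>R v)" for t
  have der: "(\<phi> has_real_derivative v \<bullet> (g (e + s *\<^sub>R u + t *\<^sub>R v) - g (e + t *\<^sub>R v))) (at t)" for t
  proof -
    have *: "((\<lambda>t. f (c + t *\<^sub>R v)) has_derivative (\<lambda>h. h * (v \<bullet> g (c + t *\<^sub>R v)))) (at t)" for c
    proof -
      have "((\<lambda>t. c + t *\<^sub>R v) has_derivative (\<lambda>h. h *\<^sub>R v)) (at t)"
        by (auto intro!: derivative_eq_intros)
      from has_derivative_compose[OF this f[unfolded gderiv_def]] show ?thesis by simp
    qed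
    show ?thesis unfolding \<phi>_def has_field_derivative_def
      by (rule has_derivative_eq_rhs[OF has_derivative_diff[OF * *]])
         (auto simp: inner_diff_right algebra_simps)
  qed
  obtain t where t: "0 < t" "t < s"
    and mvt: "\<phi> s - \<phi> 0 = s * (v \<bullet> (g (e + s *\<^sub>R u + t *\<^sub>R v) - g (e + t *\<^sub>R v)))"
    using MVT2[of 0 s \<phi>, OF \<open>0 < s\<close> der] by auto
  have K0: "0 \<le> K" and norm_v: "norm v \<le> K"
    using K norm_ge_zero[of u] norm_ge_zero[of v] by linarith+
  define h1 where "h1 = s *\<^sub>R u + t *\<^sub>R v"
  define h2 where "h2 = t *\<^sub>R v"
  have "norm h1 \<le> s * norm u + t * norm v"
    unfolding h1_def using t norm_triangle_ineq[of "s *\<^sub>R u" "t *\<^sub>R v"] by simp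
  also have "\<dots> \<le> s * norm u + s * norm v" using t by (intro add_left_mono mult_right_mono) auto
  finally have h1: "norm h1 \<le> s * K"
    using K \<open>0 < s\<close> by (smt (verit) distrib_left mult_left_mono)
  have "norm h2 \<le> s * norm v" unfolding h2_def using t by (auto intro: mult_right_mono)
  then have h2: "norm h2 \<le> s * K"
    using K \<open>0 < s\<close> norm_ge_zero[of u] by (smt (verit) mult_left_mono)
  have e1: "norm (g (e + h1) - g e - g' h1) \<le> \<epsilon> * (s * K)"
    using est[of h1] h1 \<open>s * K < \<delta>\<close> mult_left_mono[OF h1 \<open>0 \<le> \<epsilon>\<close>] by linarith
  have e2: "norm (g (e + h2) - g e - g' h2) \<le> \<epsilon> * (s * K)"
    using est[of h2] h2 \<open>s * K < \<delta>\<close> mult_left_mono[OF h2 \<open>0 \<le> \<epsilon>\<close>] by linarith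
  define R where "R = (g (e + h1) - g e - g' h1) - (g (e + h2) - g e - g' h2)"
  have "norm R \<le> 2 * \<epsilon> * (s * K)"
    using norm_triangle_ineq4[of "g (e + h1) - g e - g' h1" "g (e + h2) - g e - g' h2"] e1 e2
    unfolding R_def by linarith
  moreover have "g (e + h1) - g (e + h2) = s *\<^sub>R g' u + R"
    by (simp add: R_def h1_def h2_def add scale)
  then have "\<phi> s - \<phi> 0 - s\<^sup>2 * (v \<bullet> g' u) = s * (v \<bullet> R)"
    using mvt by (simp add: h1_def h2_def add.assoc inner_add_right distrib_left power2_eq_square)
  ultimately have "\<bar>\<phi> s - \<phi> 0 - s\<^sup>2 * (v \<bullet> g' u)\<bar> \<le> s * (norm v * (2 * \<epsilon> * (s * K)))"
    using \<open>0 < s\<close> Cauchy_Schwarz_ineq2[of v R]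
    by (auto simp: abs_mult intro: order_trans[OF _ mult_left_mono])
  also have "norm v * (2 * \<epsilon> * (s * K)) \<le> K * (2 * \<epsilon> * (s * K))"
    using norm_v \<open>0 \<le> \<epsilon>\<close> \<open>0 < s\<close> K0 by (intro mult_right_mono) auto
  finally show ?thesis
    using \<open>0 < s\<close> by (simp add: \<phi>_def power2_eq_square algebra_simps)
qed

text \<open>The second difference is unchanged when \<open>u\<close> and \<open>v\<close> are
  exchanged, yet the two orders approximate it by different sides of the equation.\<close>

lemma symmetric_second_derivative:
  fixes f :: "'a::real_inner \<Rightarrow> real"
  assumes f: "\<And>x. GDERIV f x :> g x" and g: "(g has_derivative g') (at e)"
  shows "v \<bullet> g' u = u \<bullet> g' v"
proof (rule ccontr)
  assume "v \<bullet> g' u \<noteq> u \<bullet> g' v"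
  define d where "d = \<bar>v \<bullet> g' u - u \<bullet> g' v\<bar>"
  define K where "K = norm u + norm v + 1"
  \<comment> \<open>The two errors add up to \<open>4 * \<epsilon> * K\<^sup>2\<close>, up to the
    common factor \<open>s\<^sup>2\<close>; this choice makes that half of \<open>d\<close>.\<close>
  define \<epsilon> where "\<epsilon> = d / (8 * K\<^sup>2)"
  have d: "0 < d" using \<open>v \<bullet> g' u \<noteq> u \<bullet> g' v\<close> by (simp add: d_def)
  have K: "0 < K" by (simp add: K_def add_nonneg_pos)
  have \<epsilon>: "0 < \<epsilon>" using d K by (simp add: \<epsilon>_def)
  have lin: "linear g'" using g by (rule has_derivative_linear)
  obtain \<delta> where \<delta>: "\<delta> > 0"
    and est0: "\<And>y. norm (y - e) < \<delta> \<Longrightarrow> norm (g y - g e - g' (y - e)) \<le> \<epsilon> * norm (y - e)"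
    using g \<epsilon> unfolding has_derivative_at_alt by blast
  have est: "norm (g (e + h) - g e - g' h) \<le> \<epsilon> * norm h" if "norm h < \<delta>" for h
    using est0[of "e + h"] that by simp
  define s where "s = \<delta> / (2 * K)"
  have s: "0 < s" "s * K < \<delta>" using \<delta> K by (simp_all add: s_def)
  note A = second_difference_estimate[OF f est lin less_imp_le[OF \<epsilon>] s]
  define \<Delta> where "\<Delta> = f (e + s *\<^sub>R u + s *\<^sub>R v) - f (e + s *\<^sub>R u) - f (e + s *\<^sub>R v) + f e"
  have "\<bar>\<Delta> - s\<^sup>2 * (v \<bullet> g' u)\<bar> \<le> s\<^sup>2 * (2 * \<epsilon> * K\<^sup>2)"
    using A[of u v] by (simp add: K_def \<Delta>_def)
  moreover have "\<bar>\<Delta> - s\<^sup>2 * (u \<bullet> g' v)\<bar> \<le> s\<^sup>2 * (2 * \<epsilon> * K\<^sup>2)"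
    using A[of v u] by (simp add: K_def \<Delta>_def algebra_simps)
  ultimately have "\<bar>s\<^sup>2 * (v \<bullet> g' u) - s\<^sup>2 * (u \<bullet> g' v)\<bar> \<le> s\<^sup>2 * (4 * \<epsilon> * K\<^sup>2)"
    by linarith
  then have "s\<^sup>2 * d \<le> s\<^sup>2 * (4 * \<epsilon> * K\<^sup>2)"
    by (simp add: d_def abs_mult flip: right_diff_distrib)
  then have "d \<le> 4 * \<epsilon> * K\<^sup>2" using s by simp
  also have "\<dots> = d / 2" using K by (simp add: \<epsilon>_def)
  finally show False using d by simp
qed

section \<open>Derivatives of a \<open>C\<^sup>2\<close> Hamiltonian\<close>

text \<open>Point masses witness that \<open>P2\<close> is nonempty, on which the signs of suprema
  over \<open>P2\<close> rely.\<close>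

lemma return_in_P2: "return borel z \<in> P2"
proof -
  have "integrable (return borel z) (\<lambda>x. (norm x)\<^sup>2)"
    by (rule integrable_cong_AE_imp[of _ "\<lambda>_. (norm z)\<^sup>2"])
       (auto simp: AE_return prob_space.finite_measure prob_space_return intro!: finite_measure.integrable_const)
  then show ?thesis by (simp add: P2_def prob_space_return)
qed

text \<open>The diagonal coupling has zero cost. This gives access to joint continuity at a frozen
  measure.\<close>

lemma W2_self:
  assumes "\<mu> \<in> P2" shows "W2 \<mu> \<mu> = 0"
proof -
  have \<mu>: "prob_space \<mu>" and sets: "sets \<mu> = sets borel" using assms by (auto simp: P2_def)
  have [measurable]: "(\<lambda>x. x) \<in> \<mu> \<rightarrow>\<^sub>M (borel :: 'a measure)" by (simp add: measurable_ident_sets sets)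
  have [measurable]: "(\<lambda>x. (x, x)) \<in> \<mu> \<rightarrow>\<^sub>M (borel :: ('a \<times> 'a) measure)"
    unfolding borel_prod[symmetric] by measurable
  have [measurable]: "fst \<in> borel_measurable (borel :: ('a \<times> 'a) measure)"
      "snd \<in> borel_measurable (borel :: ('a \<times> 'a) measure)"
    by (simp_all add: borel_prod[symmetric])
  let ?\<gamma> = "distr \<mu> borel (\<lambda>x. (x, x))"
  have id: "distr \<mu> borel (\<lambda>x. x) = \<mu>" using sets by (simp add: distr_id2)
  have \<gamma>: "?\<gamma> \<in> couplings \<mu> \<mu>"
    unfolding couplings_def using id \<mu>
    by (auto simp: distr_distr comp_def intro!: prob_space.prob_space_distr)
  have "(INF \<gamma>\<in>couplings \<mu> \<mu>. \<integral>z. (norm (fst z - snd z))\<^sup>2 \<partial>\<gamma>) \<le> (\<integral>z. (norm (fst z - snd z))\<^sup>2 \<partial>?\<gamma>)"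
    by (rule cINF_lower[OF _ \<gamma>]) (auto intro!: bdd_belowI2[of _ 0])
  also have "\<dots> = 0" by (subst integral_distr) auto
  finally have "(INF \<gamma>\<in>couplings \<mu> \<mu>. \<integral>z. (norm (fst z - snd z))\<^sup>2 \<partial>\<gamma>) \<le> 0" .
  moreover have "(INF \<gamma>\<in>couplings \<mu> \<mu>. \<integral>z. (norm (fst z - snd z))\<^sup>2 \<partial>\<gamma>) \<ge> 0"
    using \<gamma> by (intro cINF_greatest) auto
  ultimately show ?thesis unfolding W2_def by simp
qed

lemma jointly_continuous_imp_continuous_on:
  assumes "jointly_continuous f" "\<mu> \<in> P2"
  shows "continuous_on UNIV (\<lambda>e. f e \<mu>)"
  unfolding continuous_on_iff
proof (intro ballI allI impI)
  fix e and \<epsilon> :: real assume "\<epsilon> > 0"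
  then obtain \<delta> where "\<delta> > 0" "\<And>e' \<nu>. \<nu> \<in> P2 \<Longrightarrow> dist e' e < \<delta> \<and> W2 \<nu> \<mu> < \<delta> \<Longrightarrow> dist (f e' \<nu>) (f e \<mu>) < \<epsilon>"
    using assms unfolding jointly_continuous_def by meson
  then show "\<exists>d>0. \<forall>x'\<in>UNIV. dist x' e < d \<longrightarrow> dist (f x' \<mu>) (f e \<mu>) < \<epsilon>"
    using W2_self[OF assms(2)] assms(2) by (intro exI[of _ \<delta>]) auto
qed

lemma fully_C1_C1:
  assumes "fully_C1 G" "\<mu> \<in> P2" shows "C1 (\<lambda>e. G e \<mu>)"
  using assms jointly_continuous_imp_continuous_on[OF _ assms(2), of "\<lambda>e \<mu>. grad (\<lambda>e'. G e' \<mu>) e"]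
  unfolding fully_C1_def C1_def by auto

lemma is_cont_measure_deriv_Dmu: "fully_C1 G \<Longrightarrow> is_cont_measure_deriv G (Dmu G)"
  unfolding fully_C1_def Dmu_def by (metis someI_ex)

text \<open>The definition evaluates \<open>U\<close> only at laws of \<open>L2\<close> variables,
  and those lie in \<open>P2\<close>.\<close>

lemma is_wasserstein_gradient_cong:
  assumes "\<And>\<mu>. \<mu> \<in> P2 \<Longrightarrow> U \<mu> = U' \<mu>"
  shows "is_wasserstein_gradient U D = is_wasserstein_gradient U' D"
  unfolding is_wasserstein_gradient_def
  using assms by (simp add: Law_L2_in_P2 L2_add cong: ball_cong)

text \<open>The components of \<open>Dx H\<close> and \<open>Dp H\<close> are components of the full gradient of \<open>H\<close> only for measures
  in \<open>P2\<close>; elsewhere \<open>grad\<close> is a junk value.\<close>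

lemma is_cont_measure_deriv_Dmu_cong:
  assumes "fully_C1 G'" "\<And>e \<mu>. \<mu> \<in> P2 \<Longrightarrow> G e \<mu> = G' e \<mu>"
  shows "is_cont_measure_deriv G (Dmu G)"
proof -
  \<comment> \<open>The two chosen derivatives are not compared: the one for \<open>G'\<close>
    serves as a witness for the choice that defines \<open>Dmu G\<close>.\<close>
  have "is_cont_measure_deriv G (Dmu G')"
    using is_cont_measure_deriv_Dmu[OF assms(1)] is_wasserstein_gradient_cong[of "G _" "G' _"] assms(2)
    unfolding is_cont_measure_deriv_def by blast
  then show ?thesis unfolding Dmu_def by (rule someI[of "is_cont_measure_deriv G"])
qed

lemma jacobian_mult_eq:
  fixes f :: "real^'a \<Rightarrow> real^'b"
  assumes "(f has_derivative f') (at x)" shows "jacobian f (at x) *v v = f' v"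
proof -
  have "frechet_derivative f (at x) = f'" using assms by (metis frechet_derivative_at)
  then show ?thesis
    using assms unfolding jacobian_def by (simp add: matrix_works has_derivative_linear)
qed

locale C2_hamiltonian =
  fixes H :: "'n::finite hamiltonian"
  assumes C2: "fully_C2 (\<lambda>(x, p) \<mu>. H x \<mu> p)"
begin

text \<open>Position and momentum form one variable, so that a single symmetric Hessian contains the
  mixed blocks of both orders.\<close>

definition gradH :: "(real^'n) measure \<Rightarrow> (real^'n) \<times> (real^'n) \<Rightarrow> (real^'n) \<times> (real^'n)" where
  "gradH \<mu> = grad (\<lambda>(x, p). H x \<mu> p)"

definition hessH :: "(real^'n) measure \<Rightarrow> (real^'n) \<times> (real^'n) \<Rightarrow> (real^'n) \<times> (real^'n) \<Rightarrow> (real^'n) \<times> (real^'n)"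
  where "hessH \<mu> e = frechet_derivative (gradH \<mu>) (at e)"

lemma C1H: "\<mu> \<in> P2 \<Longrightarrow> C1 (\<lambda>(x, p). H x \<mu> p)"
  using fully_C1_C1[of "\<lambda>(x, p) \<mu>. H x \<mu> p" \<mu>] C2 by (simp add: fully_C2_def case_prod_beta')

lemma gderiv_H: "\<mu> \<in> P2 \<Longrightarrow> GDERIV (\<lambda>(x, p). H x \<mu> p) e :> gradH \<mu> e"
  unfolding gradH_def by (rule GDERIV_grad) (use C1H in \<open>unfold C1_def, blast\<close>)

lemma continuous_gradH: "\<mu> \<in> P2 \<Longrightarrow> continuous_on UNIV (gradH \<mu>)"
  using C1H unfolding C1_def gradH_def by blast

lemma fully_C1_gradH: "b \<in> Basis \<Longrightarrow> fully_C1 (\<lambda>e \<mu>. gradH \<mu> e \<bullet> b)"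
  using C2 by (simp add: fully_C2_def gradH_def case_prod_beta')

lemma hessH: "\<mu> \<in> P2 \<Longrightarrow> (gradH \<mu> has_derivative hessH \<mu> e) (at e)"
proof -
  assume \<mu>: "\<mu> \<in> P2"
  have "gradH \<mu> differentiable at e"
    unfolding differentiable_componentwise_within[of "gradH \<mu>"]
    using fully_C1_C1[OF fully_C1_gradH \<mu>] unfolding C1_def by blast
  then show ?thesis unfolding hessH_def by (simp add: frechet_derivative_works)
qed

lemma linear_hessH: "\<mu> \<in> P2 \<Longrightarrow> linear (hessH \<mu> e)"
  using hessH by (rule has_derivative_linear)

lemma hessH_symmetric: "\<mu> \<in> P2 \<Longrightarrow> v \<bullet> hessH \<mu> e u = u \<bullet> hessH \<mu> e v"
  by (rule symmetric_second_derivative[OF gderiv_H hessH])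

section \<open>Partial derivatives as blocks of the full gradient and Hessian\<close>

lemma Dx_eq: "\<mu> \<in> P2 \<Longrightarrow> Dx H x \<mu> p = fst (gradH \<mu> (x, p))"
proof -
  assume \<mu>: "\<mu> \<in> P2"
  have "((\<lambda>x. (x, p)) has_derivative (\<lambda>h. (h, 0))) (at x)" by (auto intro!: derivative_eq_intros)
  from has_derivative_compose[OF this gderiv_H[OF \<mu>, unfolded gderiv_def]]
  show ?thesis unfolding Dx_def by (intro grad_eqI) (simp add: gderiv_def inner_prod_def)
qed

lemma Dp_eq: "\<mu> \<in> P2 \<Longrightarrow> Dp H x \<mu> p = snd (gradH \<mu> (x, p))"
proof -
  assume \<mu>: "\<mu> \<in> P2"
  have "((\<lambda>p. (x, p)) has_derivative (\<lambda>h. (0, h))) (at p)" by (auto intro!: derivative_eq_intros)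
  from has_derivative_compose[OF this gderiv_H[OF \<mu>, unfolded gderiv_def]]
  show ?thesis unfolding Dp_def by (intro grad_eqI) (simp add: gderiv_def inner_prod_def)
qed

lemma Dxx_eq: "\<mu> \<in> P2 \<Longrightarrow> Dxx H x \<mu> p *v v = fst (hessH \<mu> (x, p) (v, 0))"
proof -
  assume \<mu>: "\<mu> \<in> P2"
  have "((\<lambda>x. (x, p)) has_derivative (\<lambda>h. (h, 0))) (at x)" by (auto intro!: derivative_eq_intros)
  from has_derivative_fst[OF has_derivative_compose[OF this hessH[OF \<mu>]]]
  show ?thesis unfolding Dxx_def Dx_eq[OF \<mu>] by (rule jacobian_mult_eq)
qed

lemma Dxp_eq: "\<mu> \<in> P2 \<Longrightarrow> Dxp H x \<mu> p *v v = fst (hessH \<mu> (x, p) (0, v))"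
proof -
  assume \<mu>: "\<mu> \<in> P2"
  have "((\<lambda>p. (x, p)) has_derivative (\<lambda>h. (0, h))) (at p)" by (auto intro!: derivative_eq_intros)
  from has_derivative_fst[OF has_derivative_compose[OF this hessH[OF \<mu>]]]
  show ?thesis unfolding Dxp_def Dx_eq[OF \<mu>] by (rule jacobian_mult_eq)
qed

lemma Dpp_eq: "\<mu> \<in> P2 \<Longrightarrow> Dpp H x \<mu> p *v v = snd (hessH \<mu> (x, p) (0, v))"
proof -
  assume \<mu>: "\<mu> \<in> P2"
  have "((\<lambda>p. (x, p)) has_derivative (\<lambda>h. (0, h))) (at p)" by (auto intro!: derivative_eq_intros)
  from has_derivative_snd[OF has_derivative_compose[OF this hessH[OF \<mu>]]]
  show ?thesis unfolding Dpp_def Dp_eq[OF \<mu>] by (rule jacobian_mult_eq)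
qed

text \<open>The two mixed blocks contribute \<open>dx \<bullet> (Dxp H x \<mu> q *v dq)\<close> with
  opposite signs. Completing the square in \<open>dq + \<alpha> *\<^sub>R dx\<close> then costs the
  last term.\<close>

lemma hessH_quadratic_form:
  assumes \<mu>: "\<mu> \<in> P2"
  shows "(- dx, (2 * \<alpha>) *\<^sub>R dx + dq) \<bullet> hessH \<mu> (x, q) (dx, dq) =
    2 * \<alpha> * (dx \<bullet> (Dxp H x \<mu> q *v dx)) - dx \<bullet> (Dxx H x \<mu> q *v dx)
    + (dq + \<alpha> *\<^sub>R dx) \<bullet> (Dpp H x \<mu> q *v (dq + \<alpha> *\<^sub>R dx)) - \<alpha>\<^sup>2 * (dx \<bullet> (Dpp H x \<mu> q *v dx))"
proof -
  let ?h = "hessH \<mu> (x, q)"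
  interpret linear ?h by (rule linear_hessH[OF \<mu>])
  have split: "?h (dx, dq) = ?h (dx, 0) + ?h (0, dq)" by (simp flip: add)
  \<comment> \<open>Symmetry identifies the block that differentiates \<open>Dp H\<close> in
    \<open>x\<close> with the transpose of \<open>Dxp\<close>.\<close>
  have mixed: "w \<bullet> snd (?h (dx, 0)) = dx \<bullet> (Dxp H x \<mu> q *v w)" for w
    using hessH_symmetric[OF \<mu>, of "(0, w)" "(x, q)" "(dx, 0)"]
    by (simp add: Dxp_eq[OF \<mu>] inner_prod_def)
  have pp: "u \<bullet> (Dpp H x \<mu> q *v v) = v \<bullet> (Dpp H x \<mu> q *v u)" for u v
    using hessH_symmetric[OF \<mu>, of "(0, u)" "(x, q)" "(0, v)"]
    by (simp add: Dpp_eq[OF \<mu>] inner_prod_def)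
  have "(- dx, (2 * \<alpha>) *\<^sub>R dx + dq) \<bullet> ?h (dx, dq) =
      - (dx \<bullet> (Dxx H x \<mu> q *v dx)) - dx \<bullet> (Dxp H x \<mu> q *v dq)
      + dx \<bullet> (Dxp H x \<mu> q *v ((2 * \<alpha>) *\<^sub>R dx + dq)) + ((2 * \<alpha>) *\<^sub>R dx + dq) \<bullet> (Dpp H x \<mu> q *v dq)"
    unfolding split inner_prod_def
    by (simp add: inner_add_right mixed Dpp_eq[OF \<mu>] Dxx_eq[OF \<mu>] Dxp_eq[OF \<mu>])
  then show ?thesis
    using pp[of dx dq]
    by (simp add: matrix_vector_right_distrib matrix_vector_mult_scaleR inner_add_left inner_add_right
        power2_eq_square algebra_simps)
qed

text \<open>Regularity is assumed for components of the full gradient; the basis vector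
  \<open>(axis i 1, 0)\<close> selects the one that agrees on \<open>P2\<close> with the component
  \<open>i\<close> of \<open>Dx H\<close>.\<close>

lemma wasserstein_gradient_Dx:
  "is_wasserstein_gradient (\<lambda>\<mu>. Dx H x \<mu> p $ i) (\<lambda>\<mu> z. Dxmu H x \<mu> z p $ i)"
proof -
  have "is_cont_measure_deriv (\<lambda>(y, q) \<nu>. Dx H y \<nu> q $ i) (Dmu (\<lambda>(y, q) \<nu>. Dx H y \<nu> q $ i))"
    by (rule is_cont_measure_deriv_Dmu_cong[OF fully_C1_gradH[of "(axis i 1, 0)"]])
       (auto simp: Basis_prod_def axis_in_Basis_iff Dx_eq inner_prod_def inner_axis)
  then show ?thesis unfolding is_cont_measure_deriv_def Dxmu_def by force
qed

lemma wasserstein_gradient_Dp: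
  "is_wasserstein_gradient (\<lambda>\<mu>. Dp H x \<mu> p $ i) (\<lambda>\<mu> z. Dpmu H x \<mu> z p $ i)"
proof -
  have "is_cont_measure_deriv (\<lambda>(y, q) \<nu>. Dp H y \<nu> q $ i) (Dmu (\<lambda>(y, q) \<nu>. Dp H y \<nu> q $ i))"
    by (rule is_cont_measure_deriv_Dmu_cong[OF fully_C1_gradH[of "(0, axis i 1)"]])
       (auto simp: Basis_prod_def axis_in_Basis_iff Dp_eq inner_prod_def inner_axis)
  then show ?thesis unfolding is_cont_measure_deriv_def Dpmu_def by force
qed

section \<open>The shifted Hamiltonian\<close>

lemma gderiv_shifted:
  assumes \<mu>: "\<mu> \<in> P2"
  shows "GDERIV (\<lambda>(x, p). shifted \<alpha> H x \<mu> p) (x, p) :>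
    (Dx H x \<mu> (p - \<alpha> *\<^sub>R x) - \<alpha> *\<^sub>R Dp H x \<mu> (p - \<alpha> *\<^sub>R x), Dp H x \<mu> (p - \<alpha> *\<^sub>R x))"
proof -
  \<comment> \<open>This shear is linear, hence its own derivative; its adjoint produces the
    correction by \<alpha> times \<open>Dp H\<close> in the first component.\<close>
  define T where "T e = (fst e, snd e - \<alpha> *\<^sub>R fst e)" for e :: "(real^'n) \<times> (real^'n)"
  have "(T has_derivative T) (at (x, p))"
    unfolding T_def by (auto intro!: derivative_eq_intros)
  from has_derivative_compose[OF this gderiv_H[OF \<mu>, unfolded gderiv_def]]
  have "((\<lambda>(x, p). shifted \<alpha> H x \<mu> p) has_derivative (\<lambda>h. T h \<bullet> gradH \<mu> (T (x, p)))) (at (x, p))"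
    by (simp add: T_def shifted_def case_prod_beta')
  moreover have "T h \<bullet> gradH \<mu> (T (x, p)) =
      h \<bullet> (Dx H x \<mu> (p - \<alpha> *\<^sub>R x) - \<alpha> *\<^sub>R Dp H x \<mu> (p - \<alpha> *\<^sub>R x), Dp H x \<mu> (p - \<alpha> *\<^sub>R x))" for h
    by (simp add: T_def Dx_eq[OF \<mu>] Dp_eq[OF \<mu>] inner_prod_def inner_diff_left inner_diff_right)
  ultimately show ?thesis unfolding gderiv_def by simp
qed

lemma C1_shifted:
  assumes \<mu>: "\<mu> \<in> P2" shows "C1 (\<lambda>(x, p). shifted \<alpha> H x \<mu> p)"
  unfolding C1_def
proof (intro conjI allI)
  fix e show "(\<lambda>(x, p). shifted \<alpha> H x \<mu> p) differentiable at e"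
    using gderiv_shifted[OF \<mu>, of \<alpha> "fst e" "snd e"] by (auto simp: gderiv_def differentiable_def)
next
  have "grad (\<lambda>(x, p). shifted \<alpha> H x \<mu> p) = (\<lambda>e.
      (fst (gradH \<mu> (fst e, snd e - \<alpha> *\<^sub>R fst e)) - \<alpha> *\<^sub>R snd (gradH \<mu> (fst e, snd e - \<alpha> *\<^sub>R fst e)),
       snd (gradH \<mu> (fst e, snd e - \<alpha> *\<^sub>R fst e))))"
    using grad_eqI[OF gderiv_shifted[OF \<mu>]] by (auto simp: fun_eq_iff Dx_eq[OF \<mu>] Dp_eq[OF \<mu>])
  moreover have "continuous_on UNIV (\<lambda>e. gradH \<mu> (fst e, snd e - \<alpha> *\<^sub>R fst e))"
    by (rule continuous_on_compose2[OF continuous_gradH[OF \<mu>]]) (auto intro!: continuous_intros)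
  ultimately show "continuous_on UNIV (grad (\<lambda>(x, p). shifted \<alpha> H x \<mu> p))"
    by (auto intro!: continuous_intros)
qed

lemma Dx_shifted:
  "\<mu> \<in> P2 \<Longrightarrow> Dx (shifted \<alpha> H) x \<mu> p = Dx H x \<mu> (p - \<alpha> *\<^sub>R x) - \<alpha> *\<^sub>R Dp H x \<mu> (p - \<alpha> *\<^sub>R x)"
proof -
  assume \<mu>: "\<mu> \<in> P2"
  have "((\<lambda>x. (x, p)) has_derivative (\<lambda>h. (h, 0))) (at x)" by (auto intro!: derivative_eq_intros)
  from has_derivative_compose[OF this gderiv_shifted[OF \<mu>, unfolded gderiv_def]]
  show ?thesis unfolding Dx_def[of "shifted \<alpha> H"] by (intro grad_eqI) (simp add: gderiv_def inner_prod_def)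
qed

lemma Dp_shifted: "\<mu> \<in> P2 \<Longrightarrow> Dp (shifted \<alpha> H) x \<mu> p = Dp H x \<mu> (p - \<alpha> *\<^sub>R x)"
proof -
  assume \<mu>: "\<mu> \<in> P2"
  have "((\<lambda>p. (x, p)) has_derivative (\<lambda>h. (0, h))) (at p)" by (auto intro!: derivative_eq_intros)
  from has_derivative_compose[OF this gderiv_shifted[OF \<mu>, unfolded gderiv_def]]
  show ?thesis unfolding Dp_def[of "shifted \<alpha> H"] by (intro grad_eqI) (simp add: gderiv_def inner_prod_def)
qed

end

section \<open>Displacement monotonicity\<close>

lemma norm_2_le_sup3: "bdd_above (values3 norm_2 F) \<Longrightarrow> \<mu> \<in> P2 \<Longrightarrow> norm_2 (F x \<mu> p) \<le> sup3 F"
  unfolding sup3_def by (rule cSup_upper) (auto simp: values3_def)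

lemma norm_2_le_sup4: "bdd_above (values4 norm_2 F) \<Longrightarrow> \<mu> \<in> P2 \<Longrightarrow> norm_2 (F x \<mu> z p) \<le> sup4 F"
  unfolding sup4_def by (rule cSup_upper) (auto simp: values4_def)

lemma kappa_low_le:
  assumes "bdd_below (values3 (\<lambda>A. lambda_min (Re_mat A)) F)" "\<mu> \<in> P2"
  shows "kappa_low F * (v \<bullet> v) \<le> v \<bullet> (F x \<mu> p *v v)"
proof -
  have "kappa_low F \<le> lambda_min (Re_mat (F x \<mu> p))"
    unfolding kappa_low_def using assms by (intro cInf_lower) (auto simp: values3_def)
  then have "kappa_low F * (v \<bullet> v) \<le> lambda_min (Re_mat (F x \<mu> p)) * (v \<bullet> v)"
    by (rule mult_right_mono) simp
  also have "\<dots> \<le> v \<bullet> (F x \<mu> p *v v)" by (rule lambda_min_Re_mat_le)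
  finally show ?thesis .
qed

lemma quadratic_form_le_sup3:
  assumes "bdd_above (values3 norm_2 F)" "\<mu> \<in> P2"
  shows "v \<bullet> (F x \<mu> p *v v) \<le> sup3 F * (v \<bullet> v)"
proof -
  have "v \<bullet> (F x \<mu> p *v v) \<le> norm v * (norm_2 (F x \<mu> p) * norm v)"
    by (rule order_trans[OF norm_cauchy_schwarz mult_left_mono[OF norm_matrix_vector_le_norm_2 norm_ge_zero]])
  also have "\<dots> = norm_2 (F x \<mu> p) * (v \<bullet> v)" by (simp add: dot_square_norm power2_eq_square)
  also have "\<dots> \<le> sup3 F * (v \<bullet> v)"
    by (intro mult_right_mono norm_2_le_sup3 assms) simp
  finally show ?thesis .
qed

lemma scaleR_double: "(2 * \<alpha>) *\<^sub>R u = \<alpha> *\<^sub>R u + \<alpha> *\<^sub>R (u :: 'a::real_vector)"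
  by (simp only: mult_2 scaleR_left_distrib)

text \<open>The increment is split at \<open>(x, \<nu>, q1)\<close>: the measure varies at fixed
  \<open>(x, q1)\<close>, the Euclidean variables at fixed \<nu>. The mean \<open>m\<close> belongs
  to the whole coupling and is a constant in this pointwise bound.\<close>

lemma C2_hamiltonian_displacement_lower_bound:
  fixes H :: "'n::finite hamiltonian"
  assumes C2: "fully_C2 (\<lambda>(x, p) \<mu>. H x \<mu> p)"
    and c0: "c0 > 0"
    and pp: "\<forall>x. \<forall>\<mu>\<in>P2. \<forall>p. mat_ge (Dpp H x \<mu> p) (mat (inverse c0))"
    and bdd: "bdd_below (values3 (\<lambda>A. lambda_min (Re_mat A)) (Dxp H))"
      "bdd_above (values3 norm_2 (Dpp H))" "bdd_above (values3 norm_2 (Dxx H))"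
      "bdd_above (values4 norm_2 (Dpmu H))" "bdd_above (values4 norm_2 (Dxmu H))"
    and \<alpha>: "0 \<le> \<alpha>"
    and \<mu>\<nu>: "\<mu> \<in> P2" "\<nu> \<in> P2" "\<gamma> \<in> couplings \<mu> \<nu>"
  defines "m \<equiv> \<integral>z. norm (fst z - snd z) \<partial>\<gamma>"
  shows "(2 * \<alpha> * kappa_low (Dxp H) - \<alpha>\<^sup>2 * sup3 (Dpp H) - sup3 (Dxx H)) * (norm (x - y))\<^sup>2
      - 1/4 * c0 * (sup4 (Dpmu H))\<^sup>2 * m\<^sup>2
      - (\<alpha> * sup4 (Dpmu H) + sup4 (Dxmu H)) * (norm (x - y) * m)
    \<le> - ((Dx H x \<mu> q1 - Dx H y \<nu> q2) \<bullet> (x - y))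
      + (Dp H x \<mu> q1 - Dp H y \<nu> q2) \<bullet> ((2 * \<alpha>) *\<^sub>R (x - y) + (q1 - q2))"
proof -
  interpret C2_hamiltonian H by standard (fact C2)
  define dx where "dx = x - y"
  define dq where "dq = q1 - q2"
  define w where "w = dq + \<alpha> *\<^sub>R dx"
  define v where "v = (2 * \<alpha>) *\<^sub>R dx + dq"
  define B where "B = sup4 (Dpmu H)"
  have m: "0 \<le> m" unfolding m_def by simp
  have B: "0 \<le> B"
    using norm_2_le_sup4[OF bdd(4) \<mu>\<nu>(1)] norm_2_nonneg unfolding B_def by (rule order_trans[rotated])

  \<comment> \<open>The measure step: the mean value bound is two-sided, and the terms in
    \<open>Dx\<close> and \<open>Dp\<close> enter with opposite signs, so its upper half is used
    here and its lower half for \<open>Dp\<close>.\<close>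
  have "\<bar>\<Sum>i\<in>UNIV. dx $ i * (Dx H x \<mu> q1 $ i - Dx H x \<nu> q1 $ i)\<bar> \<le> (sup4 (Dxmu H) * norm dx) * m"
    unfolding m_def
    by (rule coupling_wasserstein_gradients_mvt[OF wasserstein_gradient_Dx _ \<mu>\<nu>])
       (rule order_trans[OF norm_row_combination_le_norm_2],
        intro mult_right_mono norm_2_le_sup4 bdd norm_ge_zero)
  then have 1: "(Dx H x \<mu> q1 - Dx H x \<nu> q1) \<bullet> dx \<le> sup4 (Dxmu H) * norm dx * m"
    by (simp add: inner_commute[of _ dx] inner_vec_def[of dx] abs_le_iff)
  have "\<bar>\<Sum>i\<in>UNIV. v $ i * (Dp H x \<mu> q1 $ i - Dp H x \<nu> q1 $ i)\<bar> \<le> (B * norm v) * m"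
    unfolding m_def B_def
    by (rule coupling_wasserstein_gradients_mvt[OF wasserstein_gradient_Dp _ \<mu>\<nu>])
       (rule order_trans[OF norm_row_combination_le_norm_2],
        intro mult_right_mono norm_2_le_sup4 bdd norm_ge_zero)
  then have "- (B * norm v * m) \<le> (Dp H x \<mu> q1 - Dp H x \<nu> q1) \<bullet> v"
    by (simp add: inner_commute[of _ v] inner_vec_def[of v] abs_le_iff)
  \<comment> \<open>The vector \<open>v\<close> is measured by \<open>w\<close>, on which the
    convexity term acts, and a multiple of \<open>dx\<close>.\<close>
  moreover have "norm v \<le> norm w + \<alpha> * norm dx"
  proof -
    have "v = w + \<alpha> *\<^sub>R dx" by (simp only: v_def w_def scaleR_double add_ac)
    then show ?thesis using norm_triangle_ineq[of w "\<alpha> *\<^sub>R dx"] \<alpha> by simp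
  qed
  then have "B * norm v * m \<le> B * (norm w + \<alpha> * norm dx) * m"
    using m B by (intro mult_right_mono mult_left_mono)
  ultimately have 2: "- (B * (norm w + \<alpha> * norm dx) * m) \<le> (Dp H x \<mu> q1 - Dp H x \<nu> q1) \<bullet> v"
    by linarith

  define e where "e t = (y, q2) + t *\<^sub>R (dx, dq)" for t
  \<comment> \<open>The Euclidean step: pairing with the fixed vector \<open>(- dx, v)\<close> gives
    a scalar function, so one intermediate point serves \<open>Dx\<close> and \<open>Dp\<close>
    together.\<close>
  define \<theta> where "\<theta> t = (- dx, v) \<bullet> gradH \<nu> (e t)" for t
  have der: "(\<theta> has_real_derivative ((- dx, v) \<bullet> hessH \<nu> (e t) (dx, dq))) (at t)" for t
  proof -
    interpret h: linear "hessH \<nu> (e t)" by (rule linear_hessH[OF \<mu>\<nu>(2)])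
    have "(e has_derivative (\<lambda>h. h *\<^sub>R (dx, dq))) (at t)"
      unfolding e_def by (auto intro!: derivative_eq_intros)
    from has_derivative_inner_right[OF has_derivative_compose[OF this hessH[OF \<mu>\<nu>(2)]]]
    have "(\<theta> has_derivative (\<lambda>h. (- dx, v) \<bullet> hessH \<nu> (e t) (h *\<^sub>R (dx, dq)))) (at t)"
      unfolding \<theta>_def .
    then show ?thesis
      unfolding has_field_derivative_def by (simp only: h.scale inner_scaleR_right mult_commute_abs)
  qed
  obtain t where "\<theta> 1 - \<theta> 0 = (- dx, v) \<bullet> hessH \<nu> (e t) (dx, dq)"
    using MVT2[of 0 1 \<theta>, OF _ der] by auto
  then obtain a b where mvt: "\<theta> 1 - \<theta> 0 = (- dx, v) \<bullet> hessH \<nu> (a, b) (dx, dq)"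
    by (metis surj_pair)
  have ww: "w \<bullet> w / c0 \<le> w \<bullet> (Dpp H a \<nu> b *v w)"
    using pp \<mu>\<nu>(2) unfolding mat_ge_def
    by (simp add: matrix_vector_mult_diff_rdistrib mat_mult_vector inner_diff_right divide_inverse mult.commute)
  have "2 * \<alpha> * (kappa_low (Dxp H) * (dx \<bullet> dx)) \<le> 2 * \<alpha> * (dx \<bullet> (Dxp H a \<nu> b *v dx))"
    using \<alpha> by (intro mult_left_mono kappa_low_le bdd \<mu>\<nu>) auto
  moreover have "\<alpha>\<^sup>2 * (dx \<bullet> (Dpp H a \<nu> b *v dx)) \<le> \<alpha>\<^sup>2 * (sup3 (Dpp H) * (dx \<bullet> dx))"
    by (intro mult_left_mono quadratic_form_le_sup3 bdd \<mu>\<nu>) auto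
  moreover have "dx \<bullet> (Dxx H a \<nu> b *v dx) \<le> sup3 (Dxx H) * (dx \<bullet> dx)"
    by (intro quadratic_form_le_sup3 bdd \<mu>\<nu>)
  ultimately have 3: "(2 * \<alpha> * kappa_low (Dxp H) - \<alpha>\<^sup>2 * sup3 (Dpp H) - sup3 (Dxx H)) * (dx \<bullet> dx)
      + w \<bullet> w / c0 \<le> \<theta> 1 - \<theta> 0"
    unfolding mvt v_def hessH_quadratic_form[OF \<mu>\<nu>(2)] w_def[symmetric]
    using ww by (simp add: left_diff_distrib mult.assoc)
  have 4: "\<theta> 1 - \<theta> 0 = - ((Dx H x \<nu> q1 - Dx H y \<nu> q2) \<bullet> dx) + (Dp H x \<nu> q1 - Dp H y \<nu> q2) \<bullet> v"
    by (simp add: \<theta>_def e_def dx_def dq_def Dx_eq[OF \<mu>\<nu>(2)] Dp_eq[OF \<mu>\<nu>(2)] inner_prod_def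
        inner_diff_left inner_diff_right inner_commute)

  \<comment> \<open>Young's inequality: \<open>c0 * B * m / 2\<close> is the value of
    \<open>norm w\<close> where the convexity gain exceeds the measure cost least, and the deficit
    there is the source of \<open>1/4 * c0\<close> in \<open>L_our\<close>.\<close>
  have "0 \<le> (norm w - c0 * B * m / 2)\<^sup>2 / c0" using c0 by simp
  also have "\<dots> = w \<bullet> w / c0 - B * norm w * m + 1/4 * c0 * B\<^sup>2 * m\<^sup>2"
    using c0 by (simp add: dot_square_norm power2_diff power2_eq_square field_simps)
  finally have 5: "B * norm w * m - 1/4 * c0 * B\<^sup>2 * m\<^sup>2 \<le> w \<bullet> w / c0" by simp
  show ?thesis
    using 1 2 3 4 5
    unfolding dx_def[symmetric] dq_def[symmetric] v_def[symmetric] B_def[symmetric]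
    by (simp add: dot_square_norm inner_diff_left distrib_left distrib_right left_diff_distrib mult_ac)
qed

text \<open>After integration \<open>b\<close> and \<open>c\<close> multiply
  \<open>m\<^sup>2\<close>, and both are nonnegative. Since \<open>m\<^sup>2 \<le> S\<close>, only
  the sign of \<open>a - b - c\<close> remains to be known.\<close>

lemma displacement_monotone_shifted:
  fixes H :: "'n::finite hamiltonian"
  assumes C2: "fully_C2 (\<lambda>(x, p) \<mu>. H x \<mu> p)"
    and c0: "c0 > 0"
    and pp: "\<forall>x. \<forall>\<mu>\<in>P2. \<forall>p. mat_ge (Dpp H x \<mu> p) (mat (inverse c0))"
    and bdd: "bdd_below (values3 (\<lambda>A. lambda_min (Re_mat A)) (Dxp H))"
      "bdd_above (values3 norm_2 (Dpp H))" "bdd_above (values3 norm_2 (Dxx H))"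
      "bdd_above (values4 norm_2 (Dpmu H))" "bdd_above (values4 norm_2 (Dxmu H))"
    and \<alpha>: "0 \<le> \<alpha>"
    and quad: "sup3 (Dpp H) * \<alpha>\<^sup>2 - 2 * (kappa_low (Dxp H) - 1/2 * sup4 (Dpmu H)) * \<alpha> + L_our c0 H \<le> 0"
  shows "displacement_monotone (shifted \<alpha> H)"
  unfolding displacement_monotone_def
proof (intro conjI ballI impI)
  interpret C2_hamiltonian H by standard (fact C2)
  fix \<mu> :: "(real^'n) measure" assume \<mu>: "\<mu> \<in> P2"
  show "C1 (\<lambda>(x, p). shifted \<alpha> H x \<mu> p)" by (rule C1_shifted[OF \<mu>])
  fix \<nu> :: "(real^'n) measure" and \<gamma> p1 p2
  assume \<nu>: "\<nu> \<in> P2" and \<gamma>: "\<gamma> \<in> couplings \<mu> \<nu>"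
  let ?f = "\<lambda>(x, y). (Dx (shifted \<alpha> H) x \<mu> (p1 x) - Dx (shifted \<alpha> H) y \<nu> (p2 y)) \<bullet> (x - y)"
  let ?g = "\<lambda>(x, y). (Dp (shifted \<alpha> H) x \<mu> (p1 x) - Dp (shifted \<alpha> H) y \<nu> (p2 y)) \<bullet> (p1 x - p2 y)"
  assume "integrable \<gamma> ?f" "integrable \<gamma> ?g"
  define F where "F = ?f"
  define G where "G = ?g"
  have F: "integrable \<gamma> F" and G: "integrable \<gamma> G" unfolding F_def G_def by fact+
  have sets: "sets \<gamma> = sets borel" using \<gamma> by (simp add: couplings_def)
  interpret \<gamma>: prob_space \<gamma> using \<gamma> by (simp add: couplings_def)
  have [measurable]: "fst \<in> borel_measurable \<gamma>" "snd \<in> borel_measurable \<gamma>"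
    by (simp_all add: measurable_cong_sets[OF sets refl] borel_prod[symmetric])
  let ?d = "\<lambda>z :: (real^'n) \<times> (real^'n). norm (fst z - snd z)"
  have sq: "integrable \<gamma> (\<lambda>z. (?d z)\<^sup>2)"
  proof (rule Bochner_Integration.integrable_bound)
    show "integrable \<gamma> (\<lambda>z. 2 * (norm (fst z))\<^sup>2 + 2 * (norm (snd z))\<^sup>2)"
      using coupling_square_integrable[OF \<mu> \<nu> \<gamma>] by simp
    show "AE z in \<gamma>. norm ((?d z)\<^sup>2) \<le> norm (2 * (norm (fst z))\<^sup>2 + 2 * (norm (snd z))\<^sup>2)"
      using norm_add_squared_le[of "fst z" "- snd z" for z :: "(real^'n) \<times> (real^'n)"] by simp
  qed measurable
  have d: "integrable \<gamma> ?d" by (rule \<gamma>.square_integrable_imp_integrable[OF _ sq]) measurable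
  define m where "m = (\<integral>z. ?d z \<partial>\<gamma>)"
  define S where "S = (\<integral>z. (?d z)\<^sup>2 \<partial>\<gamma>)"
  define B where "B = sup4 (Dpmu H)"
  define a where "a = 2 * \<alpha> * kappa_low (Dxp H) - \<alpha>\<^sup>2 * sup3 (Dpp H) - sup3 (Dxx H)"
  define b where "b = 1/4 * c0 * B\<^sup>2"
  define c where "c = \<alpha> * B + sup4 (Dxmu H)"
  have "0 \<le> B" "0 \<le> sup4 (Dxmu H)"
    using norm_2_le_sup4[OF bdd(4) \<mu>] norm_2_le_sup4[OF bdd(5) \<mu>] norm_2_nonneg order_trans
    unfolding B_def by blast+
  then have bc: "0 \<le> b" "0 \<le> c" using c0 \<alpha> by (simp_all add: b_def c_def)
  have S0: "0 \<le> S" by (simp add: S_def)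
  \<comment> \<open>The variance of the distance under \<gamma> is nonnegative.\<close>
  have mS: "m\<^sup>2 \<le> S"
    using \<gamma>.variance_eq[OF d sq] \<gamma>.variance_positive[of ?d] by (simp add: m_def S_def)
  \<comment> \<open>The difference \<open>a - b - c\<close> is the negative of the polynomial in
    \<open>quad\<close>.\<close>
  have abc: "0 \<le> a - b - c"
    using quad by (simp add: a_def b_def c_def B_def L_our_def algebra_simps)
  have low: "a * (?d z)\<^sup>2 - b * m\<^sup>2 - c * (?d z * m) \<le> - F z + G z" for z
  proof -
    obtain x y where z: "z = (x, y)" by fastforce
    \<comment> \<open>Shifting the momenta absorbs one of the two multiples of \<open>x - y\<close>;
      the other matches the correction in \<open>Dx (shifted \<alpha> H)\<close>.\<close>
    have eq: "(2 * \<alpha>) *\<^sub>R (x - y) + ((p1 x - \<alpha> *\<^sub>R x) - (p2 y - \<alpha> *\<^sub>R y)) = \<alpha> *\<^sub>R (x - y) + (p1 x - p2 y)"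
      by (simp only: scaleR_double scaleR_right_diff_distrib) (simp add: algebra_simps)
    have "a * (norm (x - y))\<^sup>2 - b * m\<^sup>2 - c * (norm (x - y) * m)
      \<le> - ((Dx H x \<mu> (p1 x - \<alpha> *\<^sub>R x) - Dx H y \<nu> (p2 y - \<alpha> *\<^sub>R y)) \<bullet> (x - y))
      + (Dp H x \<mu> (p1 x - \<alpha> *\<^sub>R x) - Dp H y \<nu> (p2 y - \<alpha> *\<^sub>R y)) \<bullet> (\<alpha> *\<^sub>R (x - y) + (p1 x - p2 y))"
      using C2_hamiltonian_displacement_lower_bound[OF C2 c0 pp bdd \<alpha> \<mu> \<nu> \<gamma>,
          of x y "p1 x - \<alpha> *\<^sub>R x" "p2 y - \<alpha> *\<^sub>R y"]
      unfolding eq a_def b_def c_def B_def m_def .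
    also have "\<dots> = - F z + G z"
      unfolding F_def G_def z prod.case Dx_shifted[OF \<mu>] Dx_shifted[OF \<nu>] Dp_shifted[OF \<mu>] Dp_shifted[OF \<nu>]
      by (simp add: inner_diff_left inner_add_right algebra_simps)
    finally show ?thesis by (simp add: z)
  qed
  have "0 \<le> (a - b - c) * S" using abc S0 by simp
  also have "\<dots> \<le> a * S - b * m\<^sup>2 - c * (m * m)"
    using mult_left_mono[OF mS bc(1)] mult_left_mono[OF mS bc(2)]
    by (simp add: power2_eq_square left_diff_distrib)
  also have "\<dots> = (\<integral>z. a * (?d z)\<^sup>2 - b * m\<^sup>2 - c * (?d z * m) \<partial>\<gamma>)"
    using sq d by (simp add: S_def m_def \<gamma>.prob_space)
  also have "\<dots> \<le> (\<integral>z. - F z + G z \<partial>\<gamma>)"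
  proof (rule integral_mono[OF _ _ low])
    show "integrable \<gamma> (\<lambda>z. a * (?d z)\<^sup>2 - b * m\<^sup>2 - c * (?d z * m))" using sq d by simp
    show "integrable \<gamma> (\<lambda>z. - F z + G z)" using F G by simp
  qed
  also have "\<dots> = - integral\<^sup>L \<gamma> F + integral\<^sup>L \<gamma> G" using F G by simp
  finally show "- integral\<^sup>L \<gamma> ?f + integral\<^sup>L \<gamma> ?g \<ge> 0" unfolding F_def G_def .
qed

section \<open>Signs of the constants and the admissible shifts\<close>

lemma sup3_Dpp_pos:
  assumes "c0 > 0"
    and pp: "\<forall>x. \<forall>\<mu>\<in>P2. \<forall>p. mat_ge (Dpp H x \<mu> p) (mat (inverse c0))"
    and bdd: "bdd_above (values3 norm_2 (Dpp H))"
  shows "0 < sup3 (Dpp (H :: 'n::finite hamiltonian))"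
proof -
  \<comment> \<open>A unit vector tests the convexity bound at a point mass; the resulting strict
    sign makes the division in \<open>alpha_minus\<close> and \<open>alpha_plus\<close>
    genuine.\<close>
  define v :: "real^'n" where "v = axis undefined 1"
  have v: "v \<bullet> v = 1" by (simp add: v_def inner_axis_axis)
  have "0 \<le> v \<bullet> ((Dpp H 0 (return borel 0) 0 - mat (inverse c0)) *v v)"
    using pp return_in_P2 unfolding mat_ge_def by blast
  then have "inverse c0 \<le> v \<bullet> (Dpp H 0 (return borel 0) 0 *v v)"
    by (simp add: matrix_vector_mult_diff_rdistrib mat_mult_vector inner_diff_right v)
  also have "\<dots> \<le> sup3 (Dpp H) * (v \<bullet> v)" by (rule quadratic_form_le_sup3[OF bdd return_in_P2])
  finally have "inverse c0 \<le> sup3 (Dpp H)" using v by simp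
  with positive_imp_inverse_positive[OF \<open>c0 > 0\<close>] show ?thesis by (rule less_le_trans)
qed

text \<open>This sign keeps the root of the discriminant at most \<open>k\<close> in the theorem
  below.\<close>

lemma L_our_nonneg:
  assumes "c0 > 0" "bdd_above (values3 norm_2 (Dxx H))"
    "bdd_above (values4 norm_2 (Dpmu H))" "bdd_above (values4 norm_2 (Dxmu H))"
  shows "0 \<le> L_our c0 H"
proof -
  have "0 \<le> sup3 (Dxx H)"
    using norm_2_nonneg norm_2_le_sup3[OF assms(2) return_in_P2] by (rule order_trans)
  moreover have "0 \<le> sup4 (Dxmu H)"
    using norm_2_nonneg norm_2_le_sup4[OF assms(4) return_in_P2] by (rule order_trans)
  ultimately show ?thesis using \<open>c0 > 0\<close> by (simp add: L_our_def)
qed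

text \<open>Multiplied by \<open>P\<close>, the polynomial is
  \<open>(P * \<alpha> - k)\<^sup>2\<close> minus the discriminant.\<close>

lemma between_roots_imp_quadratic_le_0:
  fixes P k L \<alpha> :: real
  assumes "P > 0" "P * L \<le> k\<^sup>2"
    and "(k - sqrt (k\<^sup>2 - P * L)) / P \<le> \<alpha>" "\<alpha> \<le> (k + sqrt (k\<^sup>2 - P * L)) / P"
  shows "P * \<alpha>\<^sup>2 - 2 * k * \<alpha> + L \<le> 0"
proof -
  have "\<bar>P * \<alpha> - k\<bar> \<le> sqrt (k\<^sup>2 - P * L)"
    using assms by (simp add: field_simps abs_le_iff)
  then have "(P * \<alpha> - k)\<^sup>2 \<le> k\<^sup>2 - P * L" by (rule sqrt_ge_absD)
  then have "P * (P * \<alpha>\<^sup>2 - 2 * k * \<alpha> + L) \<le> P * 0"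
    by (simp add: power2_eq_square algebra_simps)
  then show ?thesis using assms(1) by (simp only: mult_le_cancel_left_pos)
qed

theorem theorem3p8:
  fixes H :: "real^'n::finite \<Rightarrow> (real^'n) measure \<Rightarrow> real^'n \<Rightarrow> real"
    and c0 :: real
  assumes "fully_C2 (\<lambda>(x, p) \<mu>. H x \<mu> p)"
    and "c0 > 0"
    and "\<forall>x. \<forall>\<mu>\<in>P2. \<forall>p. mat_ge (Dpp H x \<mu> p) (mat (inverse c0))"
    and "bdd_below (values3 (\<lambda>A. lambda_min (Re_mat A)) (Dxp H))"
    and "bdd_above (values3 norm_2 (Dpp H))"
    and "bdd_above (values3 norm_2 (Dxx H))"
    and "bdd_above (values4 norm_2 (Dpmu H))"
    and "bdd_above (values4 norm_2 (Dxmu H))"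
    and "kappa_low (Dxp H) \<ge> 1/2 * sup4 (Dpmu H) + sqrt (sup3 (Dpp H) * L_our c0 H)"
  shows "(\<forall>\<alpha>\<in>{alpha_minus c0 H..alpha_plus c0 H}. displacement_monotone (shifted \<alpha> H)) \<and>
    displacement_monotone
      (shifted ((kappa_low (Dxp H) - 1/2 * sup4 (Dpmu H)) / sup3 (Dpp H)) H)"
proof -
  define k where "k = kappa_low (Dxp H) - 1/2 * sup4 (Dpmu H)"
  define P where "P = sup3 (Dpp H)"
  define L where "L = L_our c0 H"
  define s where "s = sqrt (k\<^sup>2 - P * L)"
  have P: "0 < P" unfolding P_def by (rule sup3_Dpp_pos) (fact assms)+
  have L: "0 \<le> L" unfolding L_def by (rule L_our_nonneg) (fact assms)+
  have k: "sqrt (P * L) \<le> k" using assms(9) by (simp add: k_def P_def L_def)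
  have k0: "0 \<le> k" using k P L by (meson mult_nonneg_nonneg less_imp_le order_trans real_sqrt_ge_zero)
  have PL: "P * L \<le> k\<^sup>2" using k by (rule sqrt_le_D)
  \<comment> \<open>\<open>s \<le> k\<close> makes the lower root nonnegative, as
    \<open>displacement_monotone_shifted\<close> requires of the shift.\<close>
  have s: "0 \<le> s" "s \<le> k"
    unfolding s_def using PL P L k0 by (auto intro: real_le_lsqrt)
  have *: "displacement_monotone (shifted \<alpha> H)" if "(k - s) / P \<le> \<alpha>" "\<alpha> \<le> (k + s) / P" for \<alpha>
  proof (rule displacement_monotone_shifted[OF assms(1-8)])
    have "0 \<le> (k - s) / P" using s P by simp
    then show "0 \<le> \<alpha>" using that by linarith
    show "sup3 (Dpp H) * \<alpha>\<^sup>2 - 2 * (kappa_low (Dxp H) - 1/2 * sup4 (Dpmu H)) * \<alpha> + L_our c0 H \<le> 0"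
      using between_roots_imp_quadratic_le_0[OF P PL] that unfolding s_def k_def P_def L_def by blast
  qed
  \<comment> \<open>The shift \<open>k / P\<close> is the midpoint of the interval, which is
    nonempty because \<open>0 \<le> s\<close>.\<close>
  have "displacement_monotone (shifted (k / P) H)"
    by (rule *) (use s P in \<open>auto intro: divide_right_mono\<close>)
  then show ?thesis
    using * by (auto simp: alpha_minus_def alpha_plus_def k_def P_def L_def s_def)
qed

end
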